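(* Assume: (H') for every bounded interval $J\subset I$ there exist a positive $\psi\in C^2(\mathbb R^d)$ with $\psi(x)\to+\infty$ as $|x|\to\infty$ and $\lambda\in\mathbb R$ with $\mathcal A_{-c}(t)\psi-\lambda\psi\le0$ on $J\times\mathbb R^d$; and (H'') for every bounded interval $J\subset I$ there exist a positive $\varphi_J\in C^2(\mathbb R^d)$ with $\varphi_J(x)\to+\infty$ as $|x|\to\infty$ and $M_J>0$ with $\mathcal A(t)\varphi_J\le M_J$ on $J\times\mathbb R^d$. Then for every $f\in C_b(\mathbb R^d)$ the function $(t,s,x)\mapsto(G(t,s)f)(x)$ is continuous on $\Lambda\times\mathbb R^d$.
   Context: Let $d\ge1$, $\alpha\in(0,1)$, $I\subseteq\mathbb R$ either $\mathbb R$ or a right half-line, $\Lambda=\{(t,s)\in I\times I:t\ge s\}$. For $t\in I$, $(\mathcal A(t)\psi)(x)=\sum_{i,j}q_{ij}(t,x)D_{ij}\psi(x)+\sum_ib_i(t,x)D_i\psi(x)-c(t,x)\psi(x)$, with: $q_{ij},b_i,c\in C^{\alpha/2,\alpha}_{\rm loc}(I\times\mathbb R^d)$; $\inf c>-\infty$; $Q=(q_{ij})$ symmetric with $\langle Q(t,x)\xi,\xi\rangle\ge\eta(t,x)|\xi|^2$, $\inf\eta>0$; for every bounded interval $J\subset I$ there are positive $\phi_J\in C^2(\mathbb R^d)$ with $\phi_J\to+\infty$ at infinity and $\lambda_J$ with $\mathcal A(t)\phi_J\le\lambda_J\phi_J$ on $J\times\mathbb R^d$. $\mathcal A_{-c}(t)=\mathcal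 A(t)+c(t,\cdot)$. $G(t,s)$ is the evolution operator on $C_b(\mathbb R^d)$: $G(t,s)f=u_f(t,\cdot)$ for $t>s$, $u_f$ the unique solution (bounded on strips, in $C([s,\infty)\times\mathbb R^d)\cap C^{1+\alpha/2,2+\alpha}_{\rm loc}((s,\infty)\times\mathbb R^d)$) of $D_tu=\mathcal A(t)u$, $u(s)=f$; $G(t,t)=\mathrm{id}$. *)

theory Defs
  imports "HOL-Analysis.Analysis"
begin

definition pd :: "'d::finite \<Rightarrow> (real^'d \<Rightarrow> real) \<Rightarrow> real^'d \<Rightarrow> real" where
  "pd i f x = deriv (\<lambda>h. f (x + h *\<^sub>R axis i 1)) 0"

definition has_pd :: "'d::finite \<Rightarrow> (real^'d \<Rightarrow> real) \<Rightarrow> real^'d \<Rightarrow> bool" where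
  "has_pd i f x \<longleftrightarrow> (\<exists>D. ((\<lambda>h. f (x + h *\<^sub>R axis i 1)) has_real_derivative D) (at 0))"

definition C2 :: "(real^'d::finite \<Rightarrow> real) \<Rightarrow> bool" where
  "C2 f \<longleftrightarrow> continuous_on UNIV f \<and>
     (\<forall>i x. has_pd i f x) \<and> (\<forall>i j x. has_pd i (pd j f) x) \<and>
     (\<forall>i. continuous_on UNIV (pd i f)) \<and> (\<forall>i j. continuous_on UNIV (pd i (pd j f)))"

definition holder_loc :: "real \<Rightarrow> (real \<times> (real^'d::finite)) set \<Rightarrow> (real \<Rightarrow> real^'d \<Rightarrow> real) \<Rightarrow> bool" where
  "holder_loc \<alpha> S g \<longleftrightarrow> (\<forall>K. compact K \<and> K \<subseteq> S \<longrightarrow>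
     (\<exists>L. \<forall>(t,x)\<in>K. \<forall>(s,y)\<in>K. \<bar>g t x - g s y\<bar> \<le> L * (\<bar>t - s\<bar> powr (\<alpha>/2) + dist x y powr \<alpha>)))"

definition Aop0 :: "(real \<Rightarrow> real^'d \<Rightarrow> 'd \<Rightarrow> 'd \<Rightarrow> real) \<Rightarrow> (real \<Rightarrow> real^'d \<Rightarrow> 'd \<Rightarrow> real)
    \<Rightarrow> real \<Rightarrow> (real^'d::finite \<Rightarrow> real) \<Rightarrow> real^'d \<Rightarrow> real" where
  "Aop0 q b t \<psi> x = (\<Sum>i\<in>UNIV. \<Sum>j\<in>UNIV. q t x i j * pd i (pd j \<psi>) x) + (\<Sum>i\<in>UNIV. b t x i * pd i \<psi> x)"

definition Aop :: "(real \<Rightarrow> real^'d \<Rightarrow> 'd \<Rightarrow> 'd \<Rightarrow> real) \<Rightarrow> (real \<Rightarrow> real^'d \<Rightarrow> 'd \<Rightarrow> real)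
    \<Rightarrow> (real \<Rightarrow> real^'d \<Rightarrow> real) \<Rightarrow> real \<Rightarrow> (real^'d::finite \<Rightarrow> real) \<Rightarrow> real^'d \<Rightarrow> real" where
  "Aop q b c t \<psi> x = Aop0 q b t \<psi> x - c t x * \<psi> x"

definition standing_hyps :: "real \<Rightarrow> real set \<Rightarrow> (real \<Rightarrow> real^'d \<Rightarrow> 'd \<Rightarrow> 'd \<Rightarrow> real)
    \<Rightarrow> (real \<Rightarrow> real^'d \<Rightarrow> 'd \<Rightarrow> real) \<Rightarrow> (real \<Rightarrow> real^'d::finite \<Rightarrow> real) \<Rightarrow> bool" where
  "standing_hyps \<alpha> I q b c \<longleftrightarrow>
     0 < \<alpha> \<and> \<alpha> < 1 \<and>
     (I = UNIV \<or> (\<exists>a. I = {a..} \<or> I = {a<..})) \<and>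
     (\<forall>i j. holder_loc \<alpha> (I \<times> UNIV) (\<lambda>t x. q t x i j)) \<and>
     (\<forall>i. holder_loc \<alpha> (I \<times> UNIV) (\<lambda>t x. b t x i)) \<and>
     holder_loc \<alpha> (I \<times> UNIV) c \<and>
     (\<exists>c0. \<forall>t\<in>I. \<forall>x. c0 \<le> c t x) \<and>
     (\<forall>t\<in>I. \<forall>x i j. q t x i j = q t x j i) \<and>
     (\<exists>\<eta>. (\<forall>t\<in>I. \<forall>x \<xi>. (\<Sum>i\<in>UNIV. \<Sum>j\<in>UNIV. q t x i j * \<xi>$i * \<xi>$j) \<ge> \<eta> t x * (norm \<xi>)\<^sup>2)
          \<and> (\<exists>\<eta>0>0. \<forall>t\<in>I. \<forall>x. \<eta>0 \<le> \<eta> t x)) \<and>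
     (\<forall>J. is_interval J \<and> bounded J \<and> J \<subseteq> I \<longrightarrow>
        (\<exists>\<phi> lam. C2 \<phi> \<and> (\<forall>x. \<phi> x > 0) \<and> filterlim \<phi> at_top at_infinity \<and>
            (\<forall>t\<in>J. \<forall>x. Aop q b c t \<phi> x \<le> lam * \<phi> x)))"

text \<open>u is the classical solution of D_t u = \<A>(t)u on (s,\<infinity>) \<times> R^d, u(s) = f, in the class
  C([s,\<infinity>) \<times> R^d) \<inter> C^{1+\<alpha>/2,2+\<alpha>}_loc((s,\<infinity>) \<times> R^d), bounded on strips [s,T] \<times> R^d.
  (Normalised to 0 for t < s so that the solution is unique as a function.)\<close>
definition is_sol :: "real \<Rightarrow> (real \<Rightarrow> real^'d \<Rightarrow> 'd \<Rightarrow> 'd \<Rightarrow> real)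
    \<Rightarrow> (real \<Rightarrow> real^'d \<Rightarrow> 'd \<Rightarrow> real) \<Rightarrow> (real \<Rightarrow> real^'d::finite \<Rightarrow> real)
    \<Rightarrow> real \<Rightarrow> (real^'d \<Rightarrow> real) \<Rightarrow> (real \<Rightarrow> real^'d \<Rightarrow> real) \<Rightarrow> bool" where
  "is_sol \<alpha> q b c s f u \<longleftrightarrow>
     (\<forall>t x. t < s \<longrightarrow> u t x = 0) \<and>
     (\<forall>x. u s x = f x) \<and>
     continuous_on ({s..} \<times> UNIV) (\<lambda>(t,x). u t x) \<and>
     (\<forall>T>s. bounded ((\<lambda>(t,x). u t x) ` ({s..T} \<times> UNIV))) \<and>
     (\<exists>ut. (\<forall>t>s. \<forall>x. ((\<lambda>\<tau>. u \<tau> x) has_real_derivative ut t x) (at t)) \<and>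
           (\<forall>t>s. C2 (u t)) \<and>
           continuous_on ({s<..} \<times> UNIV) (\<lambda>(t,x). ut t x) \<and>
           (\<forall>i. continuous_on ({s<..} \<times> UNIV) (\<lambda>(t,x). pd i (u t) x)) \<and>
           (\<forall>i j. continuous_on ({s<..} \<times> UNIV) (\<lambda>(t,x). pd i (pd j (u t)) x)) \<and>
           holder_loc \<alpha> ({s<..} \<times> UNIV) ut \<and>
           (\<forall>i j. holder_loc \<alpha> ({s<..} \<times> UNIV) (\<lambda>t x. pd i (pd j (u t)) x)) \<and>
           (\<forall>t>s. \<forall>x. ut t x = Aop q b c t (u t) x))"

definition Gop :: "real \<Rightarrow> (real \<Rightarrow> real^'d \<Rightarrow> 'd \<Rightarrow> 'd \<Rightarrow> real)
    \<Rightarrow> (real \<Rightarrow> real^'d \<Rightarrow> 'd \<Rightarrow> real) \<Rightarrow> (real \<Rightarrow> real^'d::finite \<Rightarrow> real)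
    \<Rightarrow> real \<Rightarrow> real \<Rightarrow> (real^'d \<Rightarrow> real) \<Rightarrow> real^'d \<Rightarrow> real" where
  "Gop \<alpha> q b c t s f x = (if t = s then f x else (THE u. is_sol \<alpha> q b c s f u) t x)"

end

theory Submission
  imports Defs
begin

text \<open>
  Everything rests on the maximum principle. If \<open>A(t) \<phi> < \<Lambda> \<phi>\<close> and \<open>- c < \<Lambda>\<close> on a compact
  time interval, then \<open>exp (\<Lambda> (t - s)) (\<delta> + \<epsilon> \<phi>)\<close> is a strict supersolution that tends to
  infinity at infinity, so it dominates every bounded solution that it dominates at time \<open>s\<close>. On a
  unit ball around \<open>y\<close> the barrier \<open>\<eta> + C |x - y|\<^sup>2 + N (t - s)\<close> shows that \<open>G(t,s) f\<close> tends to
  \<open>f\<close> as \<open>t - s \<longrightarrow> 0\<close>, locally uniformly in \<open>x\<close> and uniformly in \<open>s\<close>. For \<open>s1 \<le> s2\<close> the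
  difference \<open>G(t,s1) f - G(t,s2) f\<close> is the bounded solution started at time \<open>s2\<close> from
  \<open>G(s2,s1) f - f\<close>. This datum is uniformly bounded and small on a large ball when \<open>s2 - s1\<close> is
  small, hence below \<open>\<delta> + \<epsilon> \<phi>\<close>, and the comparison gives local uniform continuity in \<open>s\<close>.
  Joint continuity follows, since each single solution is continuous in \<open>(t, x)\<close>.
\<close>

subsection \<open>Partial derivatives and \<open>C\<^sup>2\<close> functions\<close>

text \<open>Re-centring: \<open>pd\<close> is a derivative at parameter 0 on the axis line through
  its own point, and a shift of the parameter moves it to any point of a fixed axis line. In this
  form it can be fed to the mean value theorem.\<close>

lemma has_pd_imp_deriv:
  assumes "has_pd i f (x + h0 *\<^sub>R axis i 1)"
  shows "((\<lambda>h. f (x + h *\<^sub>R axis i 1)) has_real_derivative pd i f (x + h0 *\<^sub>R axis i 1)) (at h0)"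
proof -
  let ?g = "\<lambda>h. f (x + h *\<^sub>R axis i 1)"
  have "((\<lambda>h. f (x + h0 *\<^sub>R axis i 1 + h *\<^sub>R axis i 1)) has_real_derivative
      pd i f (x + h0 *\<^sub>R axis i 1)) (at 0)"
    using assms unfolding has_pd_def pd_def by (metis DERIV_imp_deriv)
  moreover have "(\<lambda>h. f (x + h0 *\<^sub>R axis i 1 + h *\<^sub>R axis i 1)) = (\<lambda>h. ?g (h + h0))"
    by (simp add: algebra_simps)
  ultimately show ?thesis
    using DERIV_shift[of ?g _ 0 h0] by simp
qed

lemma has_pd_imp_deriv0:
  assumes "has_pd i f x"
  shows "((\<lambda>h. f (x + h *\<^sub>R axis i 1)) has_real_derivative pd i f x) (at 0)"
  using has_pd_imp_deriv[of i f x 0] assms by simp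

lemma pd_unique:
  assumes "((\<lambda>h. f (x + h *\<^sub>R axis i 1)) has_real_derivative D) (at 0)"
  shows "has_pd i f x" "pd i f x = D"
  using assms DERIV_imp_deriv unfolding has_pd_def pd_def by blast+

lemma pd_lincomb:
  assumes "has_pd i f x" "has_pd i g x"
  shows "has_pd i (\<lambda>x. a * f x + b * g x) x"
    and "pd i (\<lambda>x. a * f x + b * g x) x = a * pd i f x + b * pd i g x"
proof -
  have "((\<lambda>h. a * f (x + h *\<^sub>R axis i 1) + b * g (x + h *\<^sub>R axis i 1))
      has_real_derivative a * pd i f x + b * pd i g x) (at 0)"
    using has_pd_imp_deriv0[OF assms(1)] has_pd_imp_deriv0[OF assms(2)]
    by (auto intro!: derivative_eq_intros)
  then show "has_pd i (\<lambda>x. a * f x + b * g x) x"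
    and "pd i (\<lambda>x. a * f x + b * g x) x = a * pd i f x + b * pd i g x"
    by (rule pd_unique)+
qed

text \<open>Stated as equalities of functions, so that they rewrite under an outer
  \<open>pd\<close>. The left side of the second is the shape that the first one leaves there, so
  both together handle second derivatives.\<close>

lemma C2_pd_lincomb:
  assumes "C2 f" "C2 g"
  shows "pd i (\<lambda>x. a * f x + b * g x) = (\<lambda>x. a * pd i f x + b * pd i g x)"
    and "pd i (\<lambda>x. a * pd j f x + b * pd j g x) = (\<lambda>x. a * pd i (pd j f) x + b * pd i (pd j g) x)"
proof -
  show "pd i (\<lambda>x. a * f x + b * g x) = (\<lambda>x. a * pd i f x + b * pd i g x)"
    using assms by (intro ext pd_lincomb) (auto simp: C2_def)
  show "pd i (\<lambda>x. a * pd j f x + b * pd j g x) = (\<lambda>x. a * pd i (pd j f) x + b * pd i (pd j g) x)"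
    using assms by (intro ext pd_lincomb) (auto simp: C2_def)
qed

lemma C2_lincomb:
  assumes "C2 f" "C2 g"
  shows "C2 (\<lambda>x. a * f x + b * g x)"
  unfolding C2_def C2_pd_lincomb[OF assms] using assms
  by (auto simp: C2_def intro!: pd_lincomb continuous_intros)

lemma Aop_lincomb:
  assumes "C2 f" "C2 g"
  shows "Aop q B c t (\<lambda>x. a * f x + b * g x) x = a * Aop q B c t f x + b * Aop q B c t g x"
  unfolding Aop_def Aop0_def C2_pd_lincomb[OF assms]
  by (simp add: algebra_simps sum.distrib sum_distrib_left)

lemma pd_const: "has_pd i (\<lambda>x. k) x" "pd i (\<lambda>x. k) x = 0"
proof -
  have "((\<lambda>h. k) has_real_derivative 0) (at 0)" by simp
  then show "has_pd i (\<lambda>x. k) x" "pd i (\<lambda>x. k) x = 0" by (rule pd_unique)+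
qed

lemma C2_const: "C2 (\<lambda>x. k)"
proof -
  have [simp]: "pd i (\<lambda>x. k) = (\<lambda>x. 0)" for i :: 'a and k by (rule ext, rule pd_const)
  show ?thesis unfolding C2_def by (auto intro: pd_const(1))
qed

lemma Aop_const: "Aop q b c t (\<lambda>x. k) x = - c t x * k"
proof -
  have [simp]: "pd i (\<lambda>x. k) = (\<lambda>x. 0)" for i :: 'a and k by (rule ext, rule pd_const)
  show ?thesis by (simp add: Aop_def Aop0_def)
qed

section \<open>The squared distance to a point, as ingredient of barriers\<close>

lemma pd_norm_square:
  "has_pd i (\<lambda>x. (norm (x - y))\<^sup>2) x" "pd i (\<lambda>x. (norm (x - y))\<^sup>2) x = 2 * (x - y) $ i"
proof -
  have "(norm (x + h *\<^sub>R axis i 1 - y))\<^sup>2 = (norm (x - y))\<^sup>2 + 2 * h * (x - y) $ i + h\<^sup>2" for h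
  proof -
    have "x + h *\<^sub>R axis i 1 - y = (x - y) + h *\<^sub>R axis i 1" by simp
    then show ?thesis
      by (simp only: power2_norm_eq_inner)
        (simp add: inner_simps inner_axis inner_commute[of "axis i 1"] power2_eq_square algebra_simps)
  qed
  then have "((\<lambda>h. (norm (x + h *\<^sub>R axis i 1 - y))\<^sup>2) has_real_derivative 2 * (x - y) $ i) (at 0)"
    by (auto intro!: derivative_eq_intros)
  then show "has_pd i (\<lambda>x. (norm (x - y))\<^sup>2) x" "pd i (\<lambda>x. (norm (x - y))\<^sup>2) x = 2 * (x - y) $ i"
    by (rule pd_unique)+
qed

lemma pd_affine:
  "has_pd i (\<lambda>x. 2 * (x - y) $ j) x"
  "pd i (\<lambda>x. 2 * (x - y) $ j) x = (if i = j then 2 else 0)"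
proof -
  have "((\<lambda>h. 2 * (x + h *\<^sub>R axis i 1 - y) $ j) has_real_derivative (if i = j then 2 else 0)) (at 0)"
    by (auto intro!: derivative_eq_intros simp: axis_def)
  then show "has_pd i (\<lambda>x. 2 * (x - y) $ j) x"
    "pd i (\<lambda>x. 2 * (x - y) $ j) x = (if i = j then 2 else 0)"
    by (rule pd_unique)+
qed

lemma C2_norm_square: "C2 (\<lambda>x. (norm (x - y))\<^sup>2)"
proof -
  have 1: "pd i (\<lambda>x. (norm (x - y))\<^sup>2) = (\<lambda>x. 2 * (x - y) $ i)" for i
    by (rule ext, rule pd_norm_square)
  have 2: "pd i (\<lambda>x. 2 * (x - y) $ j) = (\<lambda>x. if i = j then 2 else 0)" for i j
    by (rule ext, rule pd_affine)
  show ?thesis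
    unfolding C2_def 1 2
    by (auto intro!: continuous_intros pd_norm_square(1) pd_affine(1) simp del: vector_minus_component)
qed

text \<open>On the unit ball around \<open>y\<close> the gradient \<open>2 * (x - y)\<close> and the
  Hessian, twice the identity, are bounded. The three summands of the constant estimate the
  second-order, first-order and zeroth-order terms. The bound does not depend on
  \<open>y\<close>.\<close>

lemma Aop_norm_square_le:
  fixes y :: "real^'d::finite" and B :: real
  assumes q: "\<And>i j. \<bar>q t x i j\<bar> \<le> B" and b: "\<And>i. \<bar>b t x i\<bar> \<le> B" and c: "\<bar>c t x\<bar> \<le> B"
    and x: "norm (x - y) \<le> 1"
  shows "Aop q b c t (\<lambda>x. (norm (x - y))\<^sup>2) x \<le> (2 * CARD('d)^2 + 2 * CARD('d) + 1) * B"
proof -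
  have B: "B \<ge> 0" using c by linarith
  have 1: "pd i (\<lambda>x. (norm (x - y))\<^sup>2) = (\<lambda>x. 2 * (x - y) $ i)" for i
    by (rule ext, rule pd_norm_square)
  have 2: "pd i (\<lambda>x. 2 * (x - y) $ j) = (\<lambda>x. if i = j then 2 else 0)" for i j
    by (rule ext, rule pd_affine)
  have "(\<Sum>i\<in>UNIV. \<Sum>j\<in>UNIV. q t x i j * (if i = j then 2 else 0)) \<le> (\<Sum>i::'d\<in>UNIV. \<Sum>j::'d\<in>UNIV. 2 * B)"
    using q B by (intro sum_mono) (auto simp: abs_le_iff)
  moreover have "(\<Sum>i\<in>UNIV. b t x i * (2 * (x - y) $ i)) \<le> (\<Sum>i::'d\<in>UNIV. 2 * B)"
  proof (intro sum_mono)
    fix i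
    have "\<bar>(x - y) $ i\<bar> \<le> 1" using component_le_norm_cart[of "x - y" i] x by linarith
    then have "\<bar>b t x i\<bar> * \<bar>(x - y) $ i\<bar> \<le> B * 1"
      using b B by (intro mult_mono) auto
    then show "b t x i * (2 * (x - y) $ i) \<le> 2 * B"
      by (simp add: abs_mult[symmetric] del: vector_minus_component)
  qed
  moreover have "- c t x * (norm (x - y))\<^sup>2 \<le> B"
  proof -
    have "\<bar>c t x\<bar> * (norm (x - y))\<^sup>2 \<le> B * 1"
      using c x B by (intro mult_mono) (auto simp: power_le_one)
    moreover have "- c t x * (norm (x - y))\<^sup>2 \<le> \<bar>c t x\<bar> * (norm (x - y))\<^sup>2"
      by (intro mult_right_mono) auto
    ultimately show ?thesis by linarith
  qed
  ultimately show ?thesis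
    unfolding Aop_def Aop0_def 1 2 by (simp add: algebra_simps power2_eq_square)
qed

section \<open>Total derivatives and second-order conditions at a minimum\<close>

lemma norm_sum_axis_le: "norm (\<Sum>i\<in>S. h $ i *\<^sub>R axis i (1::real)) \<le> norm (h :: real^'d::finite)"
proof -
  have "(\<Sum>i\<in>S. h $ i *\<^sub>R axis i (1::real)) $ j = (if j \<in> S then h $ j else 0)" for j
    by (simp add: axis_def if_distrib[of "\<lambda>u. _ * u"] sum.delta' cong: if_cong)
  then show ?thesis
    by (intro norm_le_componentwise_cart) (simp del: sum_component)
qed

text \<open>The increment is split into steps along the coordinate axes, each controlled by the mean value theorem.\<close>

lemma has_derivative_continuous_pd:
  fixes f :: "real^'d::finite \<Rightarrow> real"
  assumes pd: "\<And>i x. has_pd i f x" and cont: "\<And>i. continuous_on UNIV (pd i f)"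
  shows "(f has_derivative (\<lambda>h. \<Sum>i\<in>UNIV. pd i f x * h $ i)) (at x)"
  unfolding has_derivative_at_alt
proof (intro conjI allI impI)
  show "bounded_linear (\<lambda>h. \<Sum>i\<in>UNIV. pd i f x * h $ i)"
    by (intro bounded_linear_sum bounded_linear_const_mult bounded_linear_vec_nth)
next
  fix e :: real assume "e > 0"
  \<comment> \<open>Each coordinate step contributes an error of at most \<open>e'\<close> times the
    norm of the increment, and there are \<open>CARD('d)\<close> steps.\<close>
  define e' where "e' = e / CARD('d)"
  have e': "e' > 0" using \<open>e > 0\<close> by (simp add: e'_def)
  have "\<forall>i. \<forall>\<^sub>F y in at x. dist (pd i f y) (pd i f x) < e'"
    using cont e' by (auto simp: continuous_on_eq_continuous_at isCont_def intro!: tendstoD)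
  then have "\<forall>\<^sub>F y in at x. \<forall>i. dist (pd i f y) (pd i f x) < e'"
    by (simp add: eventually_all_finite)
  then obtain d where d: "d > 0" "\<And>y i. y \<noteq> x \<Longrightarrow> dist y x < d \<Longrightarrow> dist (pd i f y) (pd i f x) < e'"
    unfolding eventually_at by auto
  have near: "\<bar>pd i f y - pd i f x\<bar> \<le> e'" if "dist y x < d" for y i
    using d(2)[of y i] that e' by (cases "y = x") (auto simp: dist_real_def)
  have step: "\<bar>f (x + (\<Sum>i\<in>S. h $ i *\<^sub>R axis i 1)) - f x - (\<Sum>i\<in>S. pd i f x * h $ i)\<bar>
      \<le> (\<Sum>i\<in>S. e' * \<bar>h $ i\<bar>)" if h: "norm h < d" and "finite S" for h :: "real^'d" and S
    using \<open>finite S\<close>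
  proof (induction S)
    case empty then show ?case by simp
  next
    case (insert k S)
    define y where "y = x + (\<Sum>i\<in>S. h $ i *\<^sub>R axis i 1)"
    \<comment> \<open>With the linear part subtracted, the derivative of \<open>g\<close> is the
      oscillation of \<open>pd k f\<close>, which \<open>near\<close> bounds by
      \<open>e'\<close>.\<close>
    define g where "g = (\<lambda>r. f (y + r *\<^sub>R axis k 1) - pd k f x * r)"
    have g': "(g has_real_derivative pd k f (y + r *\<^sub>R axis k 1) - pd k f x) (at r)" for r
      unfolding g_def using has_pd_imp_deriv[OF pd, where x = y and i = k and ?h0.0 = r]
      by (auto intro!: derivative_eq_intros)
    have "norm (g (h $ k) - g 0) \<le> e' * norm (h $ k - 0)"
    proof (rule field_differentiable_bound[where S = "closed_segment 0 (h $ k)"])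
      show "(g has_field_derivative pd k f (y + r *\<^sub>R axis k 1) - pd k f x)
          (at r within closed_segment 0 (h $ k))" for r
        using g' by (rule DERIV_subset) simp
      fix r assume r: "r \<in> closed_segment 0 (h $ k)"
      \<comment> \<open>An intermediate point of the step is a coordinate truncation of
        \<open>h'\<close>, and \<open>h'\<close> is no longer than \<open>h\<close>. Hence the whole
        path stays in the ball where \<open>near\<close> applies.\<close>
      define h' where "h' = (\<chi> i. if i = k then r else h $ i)"
      have "\<bar>r\<bar> \<le> \<bar>h $ k\<bar>" using r by (auto simp: closed_segment_eq_real_ivl split: if_splits)
      then have "norm h' \<le> norm h"
        by (intro norm_le_componentwise_cart) (simp add: h'_def)
      moreover have "y + r *\<^sub>R axis k 1 - x = (\<Sum>i\<in>insert k S. h' $ i *\<^sub>R axis i 1)"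
      proof -
        have "(\<Sum>i\<in>S. h' $ i *\<^sub>R axis i 1) = (\<Sum>i\<in>S. h $ i *\<^sub>R axis i (1::real))"
          using insert.hyps by (intro sum.cong) (auto simp: h'_def)
        then show ?thesis using insert.hyps by (simp add: y_def h'_def)
      qed
      then have "dist (y + r *\<^sub>R axis k 1) x \<le> norm h'"
        unfolding dist_norm by (metis norm_sum_axis_le)
      ultimately show "norm (pd k f (y + r *\<^sub>R axis k 1) - pd k f x) \<le> e'"
        using near h by simp
    qed simp_all
    then have "\<bar>f (y + h $ k *\<^sub>R axis k 1) - f y - pd k f x * h $ k\<bar> \<le> e' * \<bar>h $ k\<bar>"
      by (simp add: g_def algebra_simps)
    moreover have eq: "x + (\<Sum>i\<in>insert k S. h $ i *\<^sub>R axis i 1) = y + h $ k *\<^sub>R axis k 1"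
      using insert.hyps by (simp add: y_def)
    ultimately show ?case
      using insert.IH unfolding eq unfolding y_def[symmetric] sum.insert[OF insert.hyps] by linarith
  qed
  show "\<exists>d>0. \<forall>y. norm (y - x) < d \<longrightarrow>
      norm (f y - f x - (\<Sum>i\<in>UNIV. pd i f x * (y - x) $ i)) \<le> e * norm (y - x)"
  proof (intro exI[of _ d] conjI allI impI d(1))
    fix y assume y: "norm (y - x) < d"
    have "(\<Sum>i\<in>UNIV. e' * \<bar>(y - x) $ i\<bar>) \<le> (\<Sum>i::'d\<in>UNIV. e' * norm (y - x))"
      using e' component_le_norm_cart by (intro sum_mono mult_left_mono) (auto simp del: vector_minus_component)
    also have "\<dots> = e * norm (y - x)" by (simp add: e'_def)
    finally have le: "(\<Sum>i\<in>UNIV. e' * \<bar>(y - x) $ i\<bar>) \<le> e * norm (y - x)" .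
    have "(\<Sum>i\<in>UNIV. (y - x) $ i *\<^sub>R axis i 1) = y - x"
      by (simp add: vec_eq_iff axis_def if_distrib[of "\<lambda>u. _ * u"] cong: if_cong)
    then show "norm (f y - f x - (\<Sum>i\<in>UNIV. pd i f x * (y - x) $ i)) \<le> e * norm (y - x)"
      using step[OF y, of UNIV] le by simp
  qed
qed

text \<open>Chain rule along a line. The auxiliary fact \<open>*\<close> is used for
  \<open>f\<close> and then for every \<open>pd j f\<close>, whose partial derivatives are
  continuous because \<open>f\<close> is \<open>C2\<close>.\<close>

lemma C2_directional_derivs:
  fixes f :: "real^'d::finite \<Rightarrow> real"
  assumes "C2 f"
  shows "((\<lambda>r. f (x + r *\<^sub>R v)) has_real_derivative (\<Sum>i\<in>UNIV. pd i f (x + r *\<^sub>R v) * v $ i)) (at r)"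
    and "((\<lambda>r. \<Sum>j\<in>UNIV. pd j f (x + r *\<^sub>R v) * v $ j) has_real_derivative
      (\<Sum>i\<in>UNIV. \<Sum>j\<in>UNIV. pd i (pd j f) (x + r *\<^sub>R v) * v $ i * v $ j)) (at r)"
proof -
  have *: "((\<lambda>r. g (x + r *\<^sub>R v)) has_real_derivative (\<Sum>i\<in>UNIV. pd i g (x + r *\<^sub>R v) * v $ i)) (at r)"
    if "\<And>i x. has_pd i g x" "\<And>i. continuous_on UNIV (pd i g)" for g
  proof -
    have "((\<lambda>r. g (x + r *\<^sub>R v)) has_derivative
        (\<lambda>k. \<Sum>i\<in>UNIV. pd i g (x + r *\<^sub>R v) * (k *\<^sub>R v) $ i)) (at r)"
      by (rule has_derivative_compose[OF _ has_derivative_continuous_pd[OF that]])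
        (auto intro!: derivative_eq_intros)
    then show ?thesis
      unfolding has_field_derivative_def
      by (rule has_derivative_eq_rhs) (simp add: fun_eq_iff sum_distrib_left mult_ac)
  qed
  show "((\<lambda>r. f (x + r *\<^sub>R v)) has_real_derivative (\<Sum>i\<in>UNIV. pd i f (x + r *\<^sub>R v) * v $ i)) (at r)"
    using assms by (intro *) (auto simp: C2_def)
  have "((\<lambda>r. \<Sum>j\<in>UNIV. pd j f (x + r *\<^sub>R v) * v $ j) has_real_derivative
      (\<Sum>j\<in>UNIV. (\<Sum>i\<in>UNIV. pd i (pd j f) (x + r *\<^sub>R v) * v $ i) * v $ j)) (at r)"
    using assms by (intro DERIV_sum DERIV_cmult_right *) (auto simp: C2_def)
  also have "(\<Sum>j\<in>UNIV. (\<Sum>i\<in>UNIV. pd i (pd j f) (x + r *\<^sub>R v) * v $ i) * v $ j) =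
      (\<Sum>i\<in>UNIV. \<Sum>j\<in>UNIV. pd i (pd j f) (x + r *\<^sub>R v) * v $ i * v $ j)"
    by (subst sum.swap) (simp add: sum_distrib_right)
  finally show "((\<lambda>r. \<Sum>j\<in>UNIV. pd j f (x + r *\<^sub>R v) * v $ j) has_real_derivative
      (\<Sum>i\<in>UNIV. \<Sum>j\<in>UNIV. pd i (pd j f) (x + r *\<^sub>R v) * v $ i * v $ j)) (at r)" .
qed

text \<open>If \<open>D\<close> were negative, \<open>g'\<close> would fall below
  \<open>g' 0 = 0\<close> immediately to the right of 0, and the mean value theorem would give
  \<open>g h < g 0\<close> for a small \<open>h\<close>.\<close>

lemma second_deriv_nonneg_at_local_min:
  fixes g g' :: "real \<Rightarrow> real"
  assumes "d > 0" and g: "\<And>r. (g has_real_derivative g' r) (at r)"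
    and g'': "(g' has_real_derivative D) (at 0)"
    and min: "\<And>r. \<bar>r\<bar> < d \<Longrightarrow> g 0 \<le> g r"
  shows "g' 0 = 0" "D \<ge> 0"
proof -
  show g'0: "g' 0 = 0"
    using DERIV_local_min[OF g \<open>d > 0\<close>] min by simp
  show "D \<ge> 0"
  proof (rule ccontr)
    assume "\<not> D \<ge> 0"
    then obtain e where e: "e > 0" "\<And>h. h > 0 \<Longrightarrow> h < e \<Longrightarrow> g' h < g' 0"
      using DERIV_neg_dec_right[OF g''] by auto
    define h where "h = min d e / 2"
    have h: "0 < h" "h < d" "h < e" using \<open>d > 0\<close> e by (auto simp: h_def min_def)
    obtain z where z: "0 < z" "z < h" "g h - g 0 = (h - 0) * g' z"
      using MVT2[of 0 h g g'] h g by auto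
    have "g' z < 0" using e(2)[of z] z h g'0 by simp
    then have "h * g' z < 0" using h by (intro mult_pos_neg)
    then have "g h < g 0" using z by simp
    then show False using min[of h] h by simp
  qed
qed

text \<open>Restriction to the lines through \<open>x\<close> reduces this to one variable. The
  gradient is read off by taking coordinate directions for \<open>v\<close>.\<close>

lemma C2_local_min:
  fixes f :: "real^'d::finite \<Rightarrow> real"
  assumes f: "C2 f" and "d > 0" and min: "\<And>y. dist y x < d \<Longrightarrow> f x \<le> f y"
  shows "pd i f x = 0"
    and "(\<Sum>i\<in>UNIV. \<Sum>j\<in>UNIV. pd i (pd j f) x * v $ i * v $ j) \<ge> 0"
proof -
  have *: "(\<Sum>i\<in>UNIV. pd i f x * v $ i) = 0 \<and>
      (\<Sum>i\<in>UNIV. \<Sum>j\<in>UNIV. pd i (pd j f) x * v $ i * v $ j) \<ge> 0" for v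
  proof -
    \<comment> \<open>The summand 1 keeps the denominator positive when \<open>v\<close> is
      zero.\<close>
    define d' where "d' = d / (norm v + 1)"
    have d': "d' > 0" using \<open>d > 0\<close> by (simp add: d'_def add_nonneg_pos)
    have le: "f (x + 0 *\<^sub>R v) \<le> f (x + r *\<^sub>R v)" if "\<bar>r\<bar> < d'" for r
    proof -
      have "\<bar>r\<bar> * norm v \<le> \<bar>r\<bar> * (norm v + 1)" by (intro mult_left_mono) auto
      also have "\<dots> < d"
        using that by (simp add: d'_def pos_less_divide_eq add_nonneg_pos)
      finally show ?thesis using min[of "x + r *\<^sub>R v"] by (simp add: dist_norm)
    qed
    have D2: "((\<lambda>r. \<Sum>j\<in>UNIV. pd j f (x + r *\<^sub>R v) * v $ j) has_real_derivative
      (\<Sum>i\<in>UNIV. \<Sum>j\<in>UNIV. pd i (pd j f) x * v $ i * v $ j)) (at 0)"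
      using C2_directional_derivs(2)[OF f, of x v 0] by simp
    show ?thesis
      using second_deriv_nonneg_at_local_min[OF d' C2_directional_derivs(1)[OF f] D2 le] by simp
  qed
  show "(\<Sum>i\<in>UNIV. \<Sum>j\<in>UNIV. pd i (pd j f) x * v $ i * v $ j) \<ge> 0" using * by blast
  have "(\<Sum>k\<in>UNIV. pd k f x * axis i 1 $ k) = pd i f x"
    by (simp add: axis_def if_distrib[of "\<lambda>u. _ * u"] cong: if_cong)
  then show "pd i f x = 0" using * by metis
qed

subsection \<open>The parabolic minimum principle\<close>

text \<open>Split off the rank-one part of \<open>q\<close> belonging to the pivot \<open>k\<close> and pass to the Schur complement.\<close>

lemma trace_posdef_mult_nonneg:
  fixes q H :: "'a \<Rightarrow> 'a \<Rightarrow> real"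
  assumes "finite S"
    and "\<And>i j. i \<in> S \<Longrightarrow> j \<in> S \<Longrightarrow> q i j = q j i"
    and "\<And>v k. k \<in> S \<Longrightarrow> v k \<noteq> 0 \<Longrightarrow> (\<Sum>i\<in>S. \<Sum>j\<in>S. q i j * v i * v j) > 0"
    and "\<And>v. (\<Sum>i\<in>S. \<Sum>j\<in>S. H i j * v i * v j) \<ge> 0"
  shows "(\<Sum>i\<in>S. \<Sum>j\<in>S. q i j * H i j) \<ge> 0"
  using assms
proof (induction S arbitrary: q)
  case empty then show ?case by simp
next
  case (insert k S)
  note [simp] = \<open>finite S\<close> \<open>k \<notin> S\<close>
  note sym = insert.prems(1) and pos = insert.prems(2) and H = insert.prems(3)
  have restrict: "(\<Sum>i\<in>S. a i * (if i = k then r else v i)) = (\<Sum>i\<in>S. a i * v i)" for a v :: "'a \<Rightarrow> real" and r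
    by (intro sum.cong) auto
  have qkk: "q k k > 0"
  proof -
    have "(\<Sum>i\<in>insert k S. \<Sum>j\<in>insert k S. q i j * (if i = k then 1 else 0) * (if j = k then 1 else 0)) = q k k"
      by (simp add: sum.delta if_distrib[of "\<lambda>u. _ * u"] cong: if_cong)
    then show ?thesis using pos[of k "\<lambda>i. if i = k then 1 else 0"] by simp
  qed
  \<comment> \<open>The Schur complement of the pivot: its row and column \<open>k\<close>
    vanish.\<close>
  define p where "p i j = q i j - q i k * q j k / q k k" for i j
  have p0: "p k j = 0" "p j k = 0" if "j \<in> insert k S" for j
    using qkk sym[of j k] that by (simp_all add: p_def)
  \<comment> \<open>\<open>F\<close> is left general because the identity is used twice: with
    products \<open>w i * w j\<close> to show that \<open>p\<close> is positive definite, and with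
    \<open>H\<close> for the conclusion.\<close>
  have split: "(\<Sum>i\<in>insert k S. \<Sum>j\<in>insert k S. q i j * F i j) =
      (\<Sum>i\<in>S. \<Sum>j\<in>S. p i j * F i j) + (\<Sum>i\<in>insert k S. \<Sum>j\<in>insert k S. F i j * q i k * q j k) / q k k" for F
  proof -
    have "(\<Sum>i\<in>insert k S. \<Sum>j\<in>insert k S. q i j * F i j) =
        (\<Sum>i\<in>insert k S. \<Sum>j\<in>insert k S. p i j * F i j + F i j * q i k * q j k / q k k)"
      by (intro sum.cong) (auto simp: p_def algebra_simps)
    also have "\<dots> = (\<Sum>i\<in>insert k S. \<Sum>j\<in>insert k S. p i j * F i j) +
        (\<Sum>i\<in>insert k S. \<Sum>j\<in>insert k S. F i j * q i k * q j k) / q k k"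
      by (simp only: sum.distrib sum_divide_distrib)
    also have "(\<Sum>i\<in>insert k S. \<Sum>j\<in>insert k S. p i j * F i j) = (\<Sum>i\<in>S. \<Sum>j\<in>S. p i j * F i j)"
      by (simp add: p0)
    finally show ?thesis .
  qed
  have "(\<Sum>i\<in>S. \<Sum>j\<in>S. p i j * H i j) \<ge> 0"
  proof (rule insert.IH)
    show "p i j = p j i" if "i \<in> S" "j \<in> S" for i j
      using sym that by (simp add: p_def)
    show "(\<Sum>i\<in>S. \<Sum>j\<in>S. H i j * v i * v j) \<ge> 0" for v
    proof -
      have "(\<Sum>i\<in>S. \<Sum>j\<in>S. H i j * v i * v j) = (\<Sum>i\<in>insert k S. \<Sum>j\<in>insert k S.
          H i j * (if i = k then 0 else v i) * (if j = k then 0 else v j))"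
        by (simp, intro sum.cong) (auto intro!: sum.cong)
      then show ?thesis using H by presburger
    qed
    show "(\<Sum>i\<in>S. \<Sum>j\<in>S. p i j * v i * v j) > 0" if "m \<in> S" "v m \<noteq> 0" for v m
    proof -
      \<comment> \<open>This value at \<open>k\<close> makes the rank-one part vanish on
        \<open>w\<close>, so the form of \<open>p\<close> at \<open>v\<close> equals the form of
        \<open>q\<close> at \<open>w\<close>.\<close>
      define r where "r = - (\<Sum>j\<in>S. q j k * v j) / q k k"
      define w where "w i = (if i = k then r else v i)" for i
      have "(\<Sum>i\<in>insert k S. q i k * w i) = 0"
        using qkk by (simp add: w_def restrict) (simp add: r_def)
      moreover have "(\<Sum>i\<in>insert k S. \<Sum>j\<in>insert k S. (w i * w j) * q i k * q j k) =
          (\<Sum>i\<in>insert k S. q i k * w i) * (\<Sum>j\<in>insert k S. q j k * w j)"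
        unfolding sum_product by (intro sum.cong) auto
      ultimately have "(\<Sum>i\<in>insert k S. \<Sum>j\<in>insert k S. q i j * (w i * w j)) =
          (\<Sum>i\<in>S. \<Sum>j\<in>S. p i j * (w i * w j))"
        unfolding split by simp
      also have "\<dots> = (\<Sum>i\<in>S. \<Sum>j\<in>S. p i j * v i * v j)"
        by (intro sum.cong) (auto simp: w_def)
      finally have "(\<Sum>i\<in>insert k S. \<Sum>j\<in>insert k S. q i j * (w i * w j)) =
          (\<Sum>i\<in>S. \<Sum>j\<in>S. p i j * v i * v j)" .
      moreover have "w m \<noteq> 0" using that insert.hyps by (auto simp: w_def)
      ultimately show ?thesis
        using pos[of m w] that by (simp add: mult.assoc del: sum.insert)
    qed
  qed
  \<comment> \<open>The rank-one part paired with \<open>H\<close> is the form of \<open>H\<close>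
    at the \<open>k\<close>-th column of \<open>q\<close>, divided by the positive pivot.\<close>
  moreover have "(\<Sum>i\<in>insert k S. \<Sum>j\<in>insert k S. H i j * q i k * q j k) / q k k \<ge> 0"
    using H[of "\<lambda>i. q i k"] qkk by (intro divide_nonneg_pos)
  ultimately show ?case unfolding split by linarith
qed

text \<open>At a first zero of \<open>z\<close> the zeroth-order term of the operator vanishes, so the sign of \<open>c\<close> plays no role.\<close>

lemma parabolic_strict_minimum_principle:
  fixes z zt :: "real \<Rightarrow> real^'d::finite \<Rightarrow> real"
  assumes K: "compact K"
    and cont: "continuous_on ({s..T} \<times> K) (\<lambda>(t, x). z t x)"
    and init: "\<And>x. x \<in> K \<Longrightarrow> z s x > 0"
    and bdry: "\<And>t x. t \<in> {s..T} \<Longrightarrow> x \<in> K \<Longrightarrow> x \<notin> interior K \<Longrightarrow> z t x > 0"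
    and C2: "\<And>t. t \<in> {s<..T} \<Longrightarrow> C2 (z t)"
    and dt: "\<And>t x. t \<in> {s<..T} \<Longrightarrow> x \<in> interior K \<Longrightarrow> ((\<lambda>\<tau>. z \<tau> x) has_real_derivative zt t x) (at t)"
    and super: "\<And>t x. t \<in> {s<..T} \<Longrightarrow> x \<in> interior K \<Longrightarrow> Aop q b c t (z t) x < zt t x"
    and sym: "\<And>t x i j. t \<in> {s<..T} \<Longrightarrow> q t x i j = q t x j i"
    and elliptic: "\<And>t x v. t \<in> {s<..T} \<Longrightarrow> v \<noteq> 0 \<Longrightarrow> (\<Sum>i\<in>UNIV. \<Sum>j\<in>UNIV. q t x i j * v $ i * v $ j) > 0"
    and "t \<in> {s..T}" "x \<in> K"
  shows "z t x > 0"
proof (rule ccontr)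
  assume neg: "\<not> z t x > 0"
  \<comment> \<open>The points that violate positivity form a compact set, so there is an earliest
    time \<open>t0\<close> among them.\<close>
  define Z where "Z = ({s..T} \<times> K) \<inter> (\<lambda>(t, x). z t x) -` {..0}"
  have "closed Z"
    unfolding Z_def using K
    by (intro continuous_closed_preimage[OF cont] closed_Times) (auto intro: compact_imp_closed)
  then have "compact (({s..T} \<times> K) \<inter> Z)"
    using compact_Times[OF compact_Icc K] by (intro compact_Int_closed)
  moreover have "({s..T} \<times> K) \<inter> Z = Z" by (auto simp: Z_def)
  moreover have "(t, x) \<in> Z" using neg \<open>t \<in> {s..T}\<close> \<open>x \<in> K\<close> by (auto simp: Z_def)
  then have "Z \<noteq> {}" by blast
  moreover have "continuous_on Z fst" by (intro continuous_intros)
  ultimately obtain p where p: "p \<in> Z" "\<And>p'. p' \<in> Z \<Longrightarrow> fst p \<le> fst p'"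
    using continuous_attains_inf[of Z fst] by metis
  obtain t0 x0 where [simp]: "p = (t0, x0)" by (cases p)
  have t0: "s \<le> t0" "t0 \<le> T" and x0: "x0 \<in> K" and z0: "z t0 x0 \<le> 0"
    using p(1) by (auto simp: Z_def)
  have before: "z \<tau> y > 0" if "s \<le> \<tau>" "\<tau> < t0" "y \<in> K" for \<tau> y
    using p(2)[of "(\<tau>, y)"] that t0 by (force simp: Z_def)
  have "s < t0" using init[OF x0] z0 t0 by (cases "s = t0") auto
  \<comment> \<open>Positivity before \<open>t0\<close> passes to the limit in time. Thus
    \<open>z t0\<close> attains its minimum 0 over \<open>K\<close> at \<open>x0\<close>.\<close>
  have nonneg: "z t0 y \<ge> 0" if "y \<in> K" for y
  proof (rule continuous_ge_on_closure[where S = "{s..<t0}" and f = "\<lambda>\<tau>. z \<tau> y"])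
    have "continuous_on {s..t0} (\<lambda>\<tau>. (\<lambda>(t, x). z t x) (\<tau>, y))"
      using that t0 by (intro continuous_on_compose2[OF cont] continuous_intros) auto
    then show "continuous_on (closure {s..<t0}) (\<lambda>\<tau>. z \<tau> y)" using \<open>s < t0\<close> by simp
    show "t0 \<in> closure {s..<t0}" using \<open>s < t0\<close> by simp
    show "z \<tau> y \<ge> 0" if "\<tau> \<in> {s..<t0}" for \<tau>
      using before[of \<tau> y] that \<open>y \<in> K\<close> by simp
  qed
  have z0: "z t0 x0 = 0" using nonneg[OF x0] z0 by simp
  have int: "x0 \<in> interior K" using bdry[of t0 x0] t0 x0 z0 by auto
  then obtain e where e: "e > 0" "ball x0 e \<subseteq> K"
    by (meson interior_subset open_contains_ball open_interior subset_trans)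
  have t0': "t0 \<in> {s<..T}" using \<open>s < t0\<close> t0 by simp
  have min: "z t0 x0 \<le> z t0 y" if "dist y x0 < e" for y
    using e that nonneg[of y] z0 by (auto simp: dist_commute mem_ball subset_iff)
  note local_min = C2_local_min[OF C2[OF t0'] e(1) min]
  have "(\<Sum>i\<in>UNIV. \<Sum>j\<in>UNIV. q t0 x0 i j * pd i (pd j (z t0)) x0) \<ge> 0"
  proof (rule trace_posdef_mult_nonneg)
    show "(\<Sum>i\<in>UNIV. \<Sum>j\<in>UNIV. q t0 x0 i j * v i * v j) > 0" if "v k \<noteq> 0" for v k
    proof -
      have "(\<chi> i. v i) \<noteq> 0" using that by (auto simp: vec_eq_iff)
      from elliptic[OF t0' this, of x0] show ?thesis by simp
    qed
    show "(\<Sum>i\<in>UNIV. \<Sum>j\<in>UNIV. pd i (pd j (z t0)) x0 * v i * v j) \<ge> 0" for v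
      using local_min(2)[of "\<chi> i. v i"] by simp
  qed (use sym[OF t0'] in auto)
  then have "Aop q b c t0 (z t0) x0 \<ge> 0"
    by (simp add: Aop_def Aop0_def local_min(1) z0)
  then have "zt t0 x0 > 0" using super[OF t0' int] by simp
  \<comment> \<open>A positive time derivative at a zero forces negative values just before
    \<open>t0\<close>, contrary to the choice of \<open>t0\<close> as the earliest bad time.\<close>
  from DERIV_pos_inc_left[OF dt[OF t0' int] this]
  obtain d where d: "d > 0" "\<And>r. r > 0 \<Longrightarrow> r < d \<Longrightarrow> z (t0 - r) x0 < 0"
    using z0 by auto
  define r where "r = min d (t0 - s) / 2"
  have "r > 0" "2 * r \<le> d" "2 * r \<le> t0 - s" using d(1) \<open>s < t0\<close> by (simp_all add: r_def)
  then have "r > 0" "r < d" "s \<le> t0 - r" by linarith+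
  then show False using d(2)[of r] before[of "t0 - r" x0] x0 by simp
qed

subsection \<open>Comparison on a time strip\<close>

text \<open>Collects the data on a compact time interval. One \<Lambda> serves both \<phi> and the
  constants; the strict inequalities match the strict minimum principle, and \<Lambda> \<ge> 0 makes
  the exponential factor at least 1 after the initial time.\<close>

locale lyapunov_strip =
  fixes q :: "real \<Rightarrow> real^'d::finite \<Rightarrow> 'd \<Rightarrow> 'd \<Rightarrow> real"
    and b :: "real \<Rightarrow> real^'d \<Rightarrow> 'd \<Rightarrow> real"
    and c :: "real \<Rightarrow> real^'d \<Rightarrow> real"
    and l h \<Lambda> :: real and \<phi> :: "real^'d \<Rightarrow> real"
  assumes sym: "t \<in> {l..h} \<Longrightarrow> q t x i j = q t x j i"
    and elliptic: "t \<in> {l..h} \<Longrightarrow> v \<noteq> 0 \<Longrightarrow> (\<Sum>i\<in>UNIV. \<Sum>j\<in>UNIV. q t x i j * v $ i * v $ j) > 0"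
    and coeff_bounded: "\<exists>B. \<forall>t\<in>{l..h}. \<forall>x\<in>cball 0 R.
      (\<forall>i j. \<bar>q t x i j\<bar> \<le> B) \<and> (\<forall>i. \<bar>b t x i\<bar> \<le> B) \<and> \<bar>c t x\<bar> \<le> B"
    and \<phi>_C2: "C2 \<phi>" and \<phi>_pos: "\<phi> x > 0" and \<phi>_lim: "filterlim \<phi> at_top at_infinity"
    and \<phi>_super: "t \<in> {l..h} \<Longrightarrow> Aop q b c t \<phi> x < \<Lambda> * \<phi> x"
    and \<Lambda>_gt: "t \<in> {l..h} \<Longrightarrow> - c t x < \<Lambda>" and \<Lambda>_nonneg: "\<Lambda> \<ge> 0"
begin

text \<open>No initial datum is fixed, so that restarts at a later time and linear combinations
  remain in the class.\<close>

definition classical :: "real \<Rightarrow> (real \<Rightarrow> real^'d \<Rightarrow> real) \<Rightarrow> bool" where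
  "classical s w \<longleftrightarrow> continuous_on ({s..h} \<times> UNIV) (\<lambda>(t, x). w t x) \<and>
     (\<exists>B. \<forall>t\<in>{s..h}. \<forall>x. \<bar>w t x\<bar> \<le> B) \<and>
     (\<forall>t\<in>{s<..h}. C2 (w t)) \<and>
     (\<forall>t\<in>{s<..h}. \<forall>x. ((\<lambda>\<tau>. w \<tau> x) has_real_derivative Aop q b c t (w t) x) (at t))"

lemma classical_restart:
  assumes "classical s w" "s \<le> s'"
  shows "classical s' w"
proof -
  have "{s'..h} \<times> UNIV \<subseteq> {s..h} \<times> (UNIV :: (real^'d) set)" using assms by auto
  then show ?thesis
    using assms unfolding classical_def
    by (force intro: continuous_on_subset)
qed

lemma classical_lincomb:
  assumes u: "classical s u" and v: "classical s v"
  shows "classical s (\<lambda>t x. a * u t x + e * v t x)"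
  unfolding classical_def
proof (intro conjI ballI allI)
  show "continuous_on ({s..h} \<times> UNIV) (\<lambda>(t, x). a * u t x + e * v t x)"
    using u v unfolding classical_def case_prod_unfold by (auto intro!: continuous_intros)
  obtain B B' where B: "\<And>t x. t \<in> {s..h} \<Longrightarrow> \<bar>u t x\<bar> \<le> B" "\<And>t x. t \<in> {s..h} \<Longrightarrow> \<bar>v t x\<bar> \<le> B'"
    using u v unfolding classical_def by meson
  have "\<bar>a * u t x + e * v t x\<bar> \<le> \<bar>a\<bar> * B + \<bar>e\<bar> * B'" if "t \<in> {s..h}" for t x
    using mult_left_mono[OF B(1)[OF that, of x], of "\<bar>a\<bar>"]
      mult_left_mono[OF B(2)[OF that, of x], of "\<bar>e\<bar>"]
    by (simp add: abs_mult[symmetric])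
  then show "\<exists>B. \<forall>t\<in>{s..h}. \<forall>x. \<bar>a * u t x + e * v t x\<bar> \<le> B" by blast
  fix t assume t: "t \<in> {s<..h}"
  have C2: "C2 (u t)" "C2 (v t)" using u v t unfolding classical_def by auto
  then show "C2 (\<lambda>x. a * u t x + e * v t x)" by (rule C2_lincomb)
  fix x
  show "((\<lambda>\<tau>. a * u \<tau> x + e * v \<tau> x) has_real_derivative
      Aop q b c t (\<lambda>x. a * u t x + e * v t x) x) (at t)"
    unfolding Aop_lincomb[OF C2]
    using u v t unfolding classical_def by (auto intro!: DERIV_add DERIV_cmult)
qed

lemma \<phi>_large: "\<exists>R. \<forall>x. norm x \<ge> R \<longrightarrow> \<phi> x > m"
  using \<phi>_lim unfolding filterlim_at_top_dense eventually_at_infinity by blast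

text \<open>The minimum principle is applied to supersolution minus \<open>w\<close> on a ball that
  contains \<open>x\<close> and is so large that \<open>\<epsilon> * \<phi>\<close> exceeds the
  bound of \<open>w\<close> on its boundary.\<close>

lemma comparison:
  assumes w: "classical s w" and "l \<le> s" and "\<epsilon> > 0" "\<delta> \<ge> 0"
    and init: "\<And>x. w s x < \<delta> + \<epsilon> * \<phi> x" and t: "t \<in> {s..h}"
  shows "w t x < exp (\<Lambda> * (t - s)) * (\<delta> + \<epsilon> * \<phi> x)"
proof -
  define E where "E t = exp (\<Lambda> * (t - s))" for t
  \<comment> \<open>The factor 1 exhibits \<open>V t\<close> as a linear combination of a constant
    and \<phi>, the shape expected by \<open>C2_lincomb\<close> and
    \<open>Aop_lincomb\<close>.\<close>
  define V where "V t = (\<lambda>x. (E t * \<delta>) * 1 + (E t * \<epsilon>) * \<phi> x)" for t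
  define z where "z t = (\<lambda>x. 1 * V t x + (-1) * w t x)" for t
  have V_eq: "V t x = E t * (\<delta> + \<epsilon> * \<phi> x)" for t x by (simp add: V_def algebra_simps)
  have V_C2: "C2 (V t)" for t
    unfolding V_def by (rule C2_lincomb[OF C2_const \<phi>_C2])
  have V_super: "Aop q b c t (V t) x < \<Lambda> * V t x" if "t \<in> {l..h}" for t x
  proof -
    have "Aop q b c t (V t) x = E t * (- c t x * \<delta>) + E t * (\<epsilon> * Aop q b c t \<phi> x)"
      unfolding V_def Aop_lincomb[OF C2_const \<phi>_C2] by (simp add: Aop_const)
    also have "\<dots> < E t * (\<Lambda> * \<delta>) + E t * (\<epsilon> * (\<Lambda> * \<phi> x))"
      using \<Lambda>_gt[OF that, of x] \<phi>_super[OF that, of x] \<open>\<delta> \<ge> 0\<close> \<open>\<epsilon> > 0\<close>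
      by (intro add_le_less_mono mult_left_mono mult_strict_left_mono mult_right_mono) (auto simp: E_def)
    finally show ?thesis by (simp add: V_eq algebra_simps)
  qed
  obtain B where B: "\<And>t x. t \<in> {s..h} \<Longrightarrow> \<bar>w t x\<bar> \<le> B"
    using w unfolding classical_def by meson
  obtain R where R: "\<And>x. norm x \<ge> R \<Longrightarrow> \<phi> x > B / \<epsilon>" using \<phi>_large by meson
  define R' where "R' = max R (norm x) + 1"
  have \<phi>_cont: "continuous_on UNIV \<phi>" using \<phi>_C2 by (simp add: C2_def)
  have "z t x > 0"
  proof (rule parabolic_strict_minimum_principle[where z = z and t = t and x = x and K = "cball 0 R'" and s = s and T = h
        and zt = "\<lambda>t x. \<Lambda> * V t x - Aop q b c t (w t) x"])
    have "continuous_on ({s..h} \<times> cball 0 R') (\<lambda>p. \<phi> (snd p))"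
      by (rule continuous_on_compose2[OF \<phi>_cont]) (auto intro!: continuous_intros)
    moreover have "continuous_on ({s..h} \<times> cball 0 R') (\<lambda>(t, x). w t x)"
      using w unfolding classical_def by (elim conjE continuous_on_subset) auto
    ultimately show "continuous_on ({s..h} \<times> cball 0 R') (\<lambda>(t, x). z t x)"
      unfolding z_def V_eq E_def case_prod_unfold by (auto intro!: continuous_intros)
    show "z s x > 0" for x using init[of x] by (simp add: z_def V_eq E_def)
    show "z t x > 0" if t: "t \<in> {s..h}" and x: "x \<in> cball 0 R'" "x \<notin> interior (cball 0 R')" for t x
    proof -
      have "norm x \<ge> R" using x by (simp add: R'_def)
      then have "B < \<epsilon> * \<phi> x" using R[of x] \<open>\<epsilon> > 0\<close> by (simp add: divide_less_eq mult.commute)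
      then have "w t x < 1 * (\<delta> + \<epsilon> * \<phi> x)" using B[OF t, of x] \<open>\<delta> \<ge> 0\<close> by simp
      also have "\<dots> \<le> V t x"
        unfolding V_eq E_def using t \<Lambda>_nonneg \<open>\<delta> \<ge> 0\<close> \<open>\<epsilon> > 0\<close> \<phi>_pos[of x]
        by (intro mult_right_mono) auto
      finally show ?thesis by (simp add: z_def)
    qed
    fix t assume t: "t \<in> {s<..h}"
    then have tl: "t \<in> {l..h}" using \<open>l \<le> s\<close> by auto
    have w_t: "C2 (w t)" using w t unfolding classical_def by blast
    show "C2 (z t)" unfolding z_def by (rule C2_lincomb[OF V_C2 w_t])
    show "q t x i j = q t x j i" for x i j using sym[OF tl] .
    show "(\<Sum>i\<in>UNIV. \<Sum>j\<in>UNIV. q t x i j * v $ i * v $ j) > 0" if "v \<noteq> 0" for x v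
      using elliptic[OF tl that] .
    fix x
    have "((\<lambda>\<tau>. w \<tau> x) has_real_derivative Aop q b c t (w t) x) (at t)"
      using w t unfolding classical_def by blast
    then show "((\<lambda>\<tau>. z \<tau> x) has_real_derivative \<Lambda> * V t x - Aop q b c t (w t) x) (at t)"
      unfolding z_def V_eq E_def by (auto intro!: derivative_eq_intros)
    show "Aop q b c t (z t) x < \<Lambda> * V t x - Aop q b c t (w t) x"
      unfolding z_def Aop_lincomb[OF V_C2 w_t] using V_super[OF tl, of x] by simp
  qed (use t in \<open>auto simp: R'_def\<close>)
  then show ?thesis by (simp add: z_def V_eq E_def)
qed

lemma abs_comparison:
  assumes w: "classical s w" and "l \<le> s" and "\<epsilon> > 0" "\<delta> \<ge> 0"
    and init: "\<And>x. \<bar>w s x\<bar> < \<delta> + \<epsilon> * \<phi> x" and t: "t \<in> {s..h}"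
  shows "\<bar>w t x\<bar> < exp (\<Lambda> * (t - s)) * (\<delta> + \<epsilon> * \<phi> x)"
proof -
  have "classical s (\<lambda>t x. - w t x)"
    using classical_lincomb[OF w w, of "-1" 0] by simp
  from comparison[OF this assms(2-4) _ t, of x] comparison[OF w assms(2-4) _ t, of x]
  show ?thesis using init by (force simp: abs_less_iff)
qed

section \<open>Estimates uniform in the initial time\<close>

text \<open>The weight \<phi> is removed pointwise by letting its coefficient tend to 0. The bound
  depends only on the strip and on \<open>K\<close>, which makes the later estimates uniform in
  \<open>s\<close>.\<close>

lemma sup_bound:
  assumes u: "classical s u" and "l \<le> s" and K: "\<And>x. \<bar>u s x\<bar> \<le> K" and t: "t \<in> {s..h}"
  shows "\<bar>u t x\<bar> \<le> exp (\<Lambda> * (h - l)) * (K + 1)"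
proof (rule field_le_epsilon)
  fix e :: real assume "e > 0"
  define E where "E = exp (\<Lambda> * (h - l))"
  \<comment> \<open>With this choice the weight contributes exactly \<open>e\<close> at the given
    \<open>x\<close>.\<close>
  define \<epsilon> where "\<epsilon> = e / (E * \<phi> x)"
  have E: "E > 0" by (simp add: E_def)
  have \<epsilon>: "\<epsilon> > 0" using \<open>e > 0\<close> E \<phi>_pos[of x] by (simp add: \<epsilon>_def)
  have "K \<ge> 0" using K[of x] by linarith
  have "\<bar>u s y\<bar> < (K + 1) + \<epsilon> * \<phi> y" for y
    using K[of y] mult_pos_pos[OF \<epsilon> \<phi>_pos[of y]] by linarith
  then have "\<bar>u t x\<bar> < exp (\<Lambda> * (t - s)) * ((K + 1) + \<epsilon> * \<phi> x)"
    using \<open>K \<ge> 0\<close> by (intro abs_comparison[OF u \<open>l \<le> s\<close> \<epsilon> _ _ t]) auto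
  also have "\<dots> \<le> E * ((K + 1) + \<epsilon> * \<phi> x)"
    using t \<open>l \<le> s\<close> \<Lambda>_nonneg \<open>K \<ge> 0\<close> \<epsilon> \<phi>_pos[of x]
    by (auto simp: E_def intro!: mult_right_mono mult_left_mono add_nonneg_nonneg mult_nonneg_nonneg)
  also have "\<dots> = E * (K + 1) + e"
    using E \<phi>_pos[of x] by (simp add: \<epsilon>_def distrib_left)
  finally show "\<bar>u t x\<bar> \<le> exp (\<Lambda> * (h - l)) * (K + 1) + e" by (simp add: E_def)
qed

text \<open>The constants \<open>C\<close> and \<open>N\<close> of the barrier \<open>\<eta> + C |x - y|\<^sup>2 + N (t - s)\<close> do not depend on \<open>s\<close> or \<open>y\<close>.\<close>

lemma initial_layer:
  assumes f: "continuous_on UNIV f" and K: "\<And>x. \<bar>f x\<bar> \<le> K" and "\<epsilon> > 0"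
  shows "\<exists>\<tau>>0. \<forall>s\<in>{l..h}. \<forall>u. classical s u \<and> u s = f \<longrightarrow>
    (\<forall>t\<in>{s..h}. \<forall>y\<in>cball 0 R. t - s \<le> \<tau> \<longrightarrow> \<bar>u t y - f y\<bar> < \<epsilon>)"
proof -
  define \<eta> where "\<eta> = \<epsilon> / 2"
  define K' where "K' = exp (\<Lambda> * (h - l)) * (K + 1)"
  have \<eta>: "\<eta> > 0" using \<open>\<epsilon> > 0\<close> by (simp add: \<eta>_def)
  have "K \<ge> 0" using K[of 0] by linarith
  then have "K' \<ge> 0" by (simp add: K'_def)
  \<comment> \<open>The enlarged radius covers the unit ball around every \<open>y\<close> in
    \<open>cball 0 R\<close>.\<close>
  have "uniformly_continuous_on (cball 0 (R + 1)) f"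
    using f by (intro compact_uniformly_continuous) (auto elim: continuous_on_subset)
  then obtain d where d: "d > 0"
    "\<And>x y. x \<in> cball 0 (R + 1) \<Longrightarrow> y \<in> cball 0 (R + 1) \<Longrightarrow> dist x y < d \<Longrightarrow> \<bar>f x - f y\<bar> < \<eta>"
    using \<eta> unfolding uniformly_continuous_on_def dist_real_def by metis
  \<comment> \<open>The part \<open>K' + K\<close> controls the lateral boundary, where the distance
    to \<open>y\<close> is 1. The part \<open>2 * K / d\<^sup>2\<close> controls the initial slice
    at distance at least \<open>d\<close> from \<open>y\<close>; nearer points are covered by
    \<eta>.\<close>
  define C where "C = K' + K + 2 * K / d\<^sup>2"
  have C: "C \<ge> K' + K" "C \<ge> 2 * K / d\<^sup>2" "C \<ge> 0"
    using \<open>K \<ge> 0\<close> \<open>K' \<ge> 0\<close> by (auto simp: C_def)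
  obtain B where B: "\<And>t x. t \<in> {l..h} \<Longrightarrow> x \<in> cball 0 (R + 1) \<Longrightarrow>
      (\<forall>i j. \<bar>q t x i j\<bar> \<le> B) \<and> (\<forall>i. \<bar>b t x i\<bar> \<le> B) \<and> \<bar>c t x\<bar> \<le> B"
    using coeff_bounded by meson
  define D where "D = (2 * CARD('d)^2 + 2 * CARD('d) + 1) * B"
  \<comment> \<open>The time slope must beat the operator on the barrier:
    \<open>C * \<bar>D\<bar>\<close> for the quadratic term,
    \<open>\<bar>B\<bar> * (2 * \<eta> + K)\<close> for the zeroth-order action on \<open>W\<close>,
    and 1 for strictness.\<close>
  define N where "N = C * \<bar>D\<bar> + \<bar>B\<bar> * (2 * \<eta> + K) + 1"
  have N: "N > 0" using C \<open>K \<ge> 0\<close> \<eta> by (auto simp: N_def intro!: add_nonneg_pos)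
  \<comment> \<open>The sign \<sigma> treats the upper and the lower estimate at once.\<close>
  have "\<sigma> * (u t y - f y) < \<epsilon>"
    if s: "s \<in> {l..h}" and u: "classical s u" "u s = f" and t: "t \<in> {s..h}" and y: "y \<in> cball 0 R"
      and ts: "t - s \<le> \<eta> / N" and \<sigma>: "\<bar>\<sigma>\<bar> = 1" for s u t y and \<sigma> :: real
  proof -
    define W where "W t = \<eta> + N * (t - s) + \<sigma> * f y" for t
    define V where "V t = (\<lambda>x. C * (norm (x - y))\<^sup>2 + W t * 1)" for t
    define z where "z t = (\<lambda>x. 1 * V t x + (- \<sigma>) * u t x)" for t
    have V_C2: "C2 (V t)" for t
      unfolding V_def by (rule C2_lincomb[OF C2_norm_square C2_const])
    have \<sigma>_le: "\<bar>\<sigma> * r\<bar> = \<bar>r\<bar>" for r using \<sigma> by (simp add: abs_mult)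
    have sub: "x \<in> cball 0 (R + 1)" if "norm (x - y) \<le> 1" for x
      using norm_triangle_sub[of x y] that y by simp
    have late: "N * (r - s) \<le> \<eta>" if "r \<le> t" for r
    proof -
      have "N * (r - s) \<le> N * (\<eta> / N)" using that ts N by (intro mult_left_mono) auto
      then show ?thesis using N by simp
    qed
    have "z t y > 0"
    \<comment> \<open>The cylinder ends at \<open>t\<close> itself, so that \<open>late\<close>
      keeps \<open>N * (r - s)\<close> below \<eta> at all its times.\<close>
    proof (rule parabolic_strict_minimum_principle[where z = z and t = t and x = y and K = "cball y 1" and s = s and T = t
          and zt = "\<lambda>t x. N - \<sigma> * Aop q b c t (u t) x"])
      have "continuous_on ({s..t} \<times> cball y 1) (\<lambda>(t, x). u t x)"
        using u t unfolding classical_def by (elim conjE continuous_on_subset) auto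
      then show "continuous_on ({s..t} \<times> cball y 1) (\<lambda>(t, x). z t x)"
        unfolding z_def V_def W_def case_prod_unfold by (auto intro!: continuous_intros)
      show "z s x > 0" if "x \<in> cball y 1" for x
      proof -
        have "\<bar>f x - f y\<bar> < \<eta> + C * (norm (x - y))\<^sup>2"
        proof (cases "dist x y < d")
          case True
          then have "\<bar>f x - f y\<bar> < \<eta>"
            using that sub[of x] sub[of y] by (intro d(2)) (auto simp: dist_norm norm_minus_commute)
          moreover have "C * (norm (x - y))\<^sup>2 \<ge> 0" using C by simp
          ultimately show ?thesis by linarith
        next
          case False
          then have "d\<^sup>2 \<le> (norm (x - y))\<^sup>2" using d(1) by (intro power_mono) (auto simp: dist_norm)
          then have "2 * K / d\<^sup>2 * d\<^sup>2 \<le> C * (norm (x - y))\<^sup>2" using C by (intro mult_mono) auto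
          then show ?thesis using d(1) K[of x] K[of y] \<eta> by simp
        qed
        then show ?thesis
          using \<sigma>_le[of "f x - f y"] u(2) by (simp add: z_def V_def W_def algebra_simps)
      qed
      show "z r x > 0" if r: "r \<in> {s..t}" and x: "x \<in> cball y 1" "x \<notin> interior (cball y 1)" for r x
      proof -
        have "norm (x - y) = 1" using x by (simp add: dist_norm norm_minus_commute)
        have "\<bar>u r x\<bar> \<le> K'"
          unfolding K'_def using s t r K u(2) by (intro sup_bound[OF u(1)]) auto
        then have "\<bar>u r x - f y\<bar> \<le> C" using K[of y] C(1) by linarith
        then have "\<sigma> * u r x - \<sigma> * f y \<le> C" using \<sigma>_le[of "u r x - f y"] by (simp add: right_diff_distrib)
        moreover have "N * (r - s) \<ge> 0" using N r by simp
        ultimately show ?thesis using \<open>norm (x - y) = 1\<close> \<eta> by (simp add: z_def V_def W_def)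
      qed
      fix r assume r: "r \<in> {s<..t}"
      then have rl: "r \<in> {l..h}" and rs: "r \<in> {s<..h}" using s t by auto
      have u_r: "C2 (u r)" using u rs unfolding classical_def by blast
      show "C2 (z r)" unfolding z_def by (rule C2_lincomb[OF V_C2 u_r])
      show "q r x i j = q r x j i" for x i j using sym[OF rl] .
      show "(\<Sum>i\<in>UNIV. \<Sum>j\<in>UNIV. q r x i j * v $ i * v $ j) > 0" if "v \<noteq> 0" for x v
        using elliptic[OF rl that] .
      fix x assume x: "x \<in> interior (cball y 1)"
      have "((\<lambda>\<tau>. u \<tau> x) has_real_derivative Aop q b c r (u r) x) (at r)"
        using u rs unfolding classical_def by blast
      then show "((\<lambda>\<tau>. z \<tau> x) has_real_derivative N - \<sigma> * Aop q b c r (u r) x) (at r)"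
        unfolding z_def V_def W_def by (auto intro!: derivative_eq_intros)
      have x1: "norm (x - y) \<le> 1" using x by (simp add: dist_norm norm_minus_commute)
      note Bx = B[OF rl sub[OF x1]]
      have "Aop q b c r (\<lambda>x. (norm (x - y))\<^sup>2) x \<le> D"
        unfolding D_def using Bx x1 by (intro Aop_norm_square_le) auto
      then have "C * Aop q b c r (\<lambda>x. (norm (x - y))\<^sup>2) x \<le> C * \<bar>D\<bar>"
        using C by (intro mult_left_mono) auto
      moreover have "W r * - c r x \<le> \<bar>B\<bar> * (2 * \<eta> + K)"
      proof -
        have "N * (r - s) \<ge> 0" "N * (r - s) \<le> \<eta>" using N r late[of r] by auto
        then have "\<bar>W r\<bar> \<le> 2 * \<eta> + K"
          using \<sigma>_le[of "f y"] K[of y] \<eta> unfolding W_def by linarith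
        then have "\<bar>W r\<bar> * \<bar>c r x\<bar> \<le> (2 * \<eta> + K) * \<bar>B\<bar>"
          using Bx by (intro mult_mono) auto
        then show ?thesis
          using abs_ge_self[of "W r * - c r x"] by (simp add: abs_mult mult.commute)
      qed
      moreover have "Aop q b c r (V r) x = C * Aop q b c r (\<lambda>x. (norm (x - y))\<^sup>2) x + W r * - c r x"
        unfolding V_def Aop_lincomb[OF C2_norm_square C2_const] by (simp add: Aop_const)
      ultimately show "Aop q b c r (z r) x < N - \<sigma> * Aop q b c r (u r) x"
        unfolding z_def Aop_lincomb[OF V_C2 u_r] N_def by simp
    qed (use t in auto)
    then have "\<sigma> * (u t y - f y) < \<eta> + N * (t - s)" by (simp add: z_def V_def W_def algebra_simps)
    then show ?thesis using late[of t] by (simp add: \<eta>_def)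
  qed
  note bound = this
  show ?thesis
  proof (intro exI[of _ "\<eta> / N"] conjI ballI allI impI)
    show "\<eta> / N > 0" using \<eta> N by simp
    fix s t u and y :: "real^'d"
    assume "s \<in> {l..h}" "classical s u \<and> u s = f" "t \<in> {s..h}" "y \<in> cball 0 R" "t - s \<le> \<eta> / N"
    then show "\<bar>u t y - f y\<bar> < \<epsilon>"
      using bound[of s u t y 1] bound[of s u t y "-1"] by (simp add: abs_less_iff)
  qed
qed

text \<open>The constants are chosen in the order \<open>\<delta>\<close>, \<open>e\<close>,
  \<open>R'\<close>, \<tau>. Outside \<open>cball 0 R'\<close> the weight \<open>e * \<phi>\<close>
  absorbs the crude bound \<open>K' + K\<close> of the restarted datum; inside,
  \<open>initial_layer\<close> makes the datum smaller than \<delta>.\<close>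

lemma stability_initial_time:
  assumes f: "continuous_on UNIV f" and K: "\<And>x. \<bar>f x\<bar> \<le> K" and "\<epsilon> > 0"
  shows "\<exists>\<tau>>0. \<forall>s1\<in>{l..h}. \<forall>s2\<in>{s1..h}. \<forall>u1 u2.
    classical s1 u1 \<and> u1 s1 = f \<and> classical s2 u2 \<and> u2 s2 = f \<and> s2 - s1 \<le> \<tau> \<longrightarrow>
    (\<forall>t\<in>{s2..h}. \<forall>x\<in>cball 0 R. \<bar>u1 t x - u2 t x\<bar> < \<epsilon>)"
proof -
  define E where "E = exp (\<Lambda> * (h - l))"
  define K' where "K' = E * (K + 1)"
  have E: "E > 0" by (simp add: E_def)
  have "continuous_on (cball 0 R) \<phi>" using \<phi>_C2 by (auto simp: C2_def elim: continuous_on_subset)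
  then have "compact (\<phi> ` cball 0 R)" by (intro compact_continuous_image) auto
  then have "bounded (\<phi> ` cball 0 R)" by (rule compact_imp_bounded)
  then obtain P where P: "P > 0" "\<And>x. x \<in> cball 0 R \<Longrightarrow> \<bar>\<phi> x\<bar> \<le> P"
    unfolding bounded_pos by auto
  \<comment> \<open>After amplification by \<open>E\<close>, the terms \<open>\<delta>\<close> and
    \<open>e * P\<close> each account for half of \<epsilon>; \<open>P\<close> bounds \<phi> on
    \<open>cball 0 R\<close>.\<close>
  define \<delta> where "\<delta> = \<epsilon> / (2 * E)"
  define e where "e = \<epsilon> / (2 * E * P)"
  have \<delta>: "\<delta> > 0" and e: "e > 0" using \<open>\<epsilon> > 0\<close> E P by (auto simp: \<delta>_def e_def)
  obtain R' where R': "\<And>x. norm x \<ge> R' \<Longrightarrow> \<phi> x > (K' + K) / e" using \<phi>_large by meson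
  obtain \<tau> where \<tau>: "\<tau> > 0" "\<And>s u t y. s \<in> {l..h} \<Longrightarrow> classical s u \<Longrightarrow> u s = f \<Longrightarrow>
      t \<in> {s..h} \<Longrightarrow> y \<in> cball 0 R' \<Longrightarrow> t - s \<le> \<tau> \<Longrightarrow> \<bar>u t y - f y\<bar> < \<delta>"
    using initial_layer[OF f K \<delta>, of R'] by meson
  have "\<bar>u1 t x - u2 t x\<bar> < \<epsilon>"
    if s1: "s1 \<in> {l..h}" and s2: "s2 \<in> {s1..h}" and u1: "classical s1 u1" "u1 s1 = f"
      and u2: "classical s2 u2" "u2 s2 = f" and close: "s2 - s1 \<le> \<tau>"
      and t: "t \<in> {s2..h}" and x: "x \<in> cball 0 R" for s1 s2 u1 u2 t x
  proof -
    have "classical s2 (\<lambda>t x. u1 t x - u2 t x)"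
      using classical_lincomb[OF classical_restart[OF u1(1), of s2] u2(1), of 1 "-1"] s2 by simp
    moreover have "l \<le> s2" using s1 s2 by simp
    moreover have "\<bar>u1 s2 x - u2 s2 x\<bar> < \<delta> + e * \<phi> x" for x
    proof (cases "norm x \<le> R'")
      case True
      then have "\<bar>u1 s2 x - f x\<bar> < \<delta>" using s1 s2 u1 close by (intro \<tau>(2)) auto
      moreover have "e * \<phi> x > 0" using e \<phi>_pos by simp
      ultimately show ?thesis using u2 by simp
    next
      case False
      then have "K' + K < e * \<phi> x" using R'[of x] e by (simp add: divide_less_eq mult.commute)
      moreover have "\<bar>u1 s2 x\<bar> \<le> K'"
        unfolding K'_def E_def using s1 s2 K u1(2) by (intro sup_bound[OF u1(1)]) auto
      ultimately show ?thesis using K[of x] \<delta> unfolding u2(2) by linarith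
    qed
    ultimately have "\<bar>u1 t x - u2 t x\<bar> < exp (\<Lambda> * (t - s2)) * (\<delta> + e * \<phi> x)"
      using e \<delta> t by (intro abs_comparison) auto
    also have "\<dots> \<le> E * (\<delta> + e * P)"
    proof (intro mult_mono add_left_mono)
      show "exp (\<Lambda> * (t - s2)) \<le> E"
        using t \<open>l \<le> s2\<close> \<Lambda>_nonneg by (auto simp: E_def intro!: mult_left_mono)
      show "0 \<le> \<delta> + e * \<phi> x" using e \<delta> \<phi>_pos[of x] by simp
    qed (use e E P x less_imp_le[OF \<phi>_pos] in \<open>auto simp: abs_le_iff\<close>)
    also have "\<dots> = \<epsilon>" using E P by (simp add: \<delta>_def e_def field_simps)
    finally show ?thesis .
  qed
  with \<tau>(1) show ?thesis by (intro exI[of _ \<tau>]) blast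
qed

end

subsection \<open>Continuity of the evolution operator\<close>

text \<open>Comparison with one reference point \<open>(s, y)\<close> of the compact set: the
  Hoelder estimate and the finite distance \<open>D\<close> bound the deviation from
  \<open>g s y\<close>.\<close>

lemma holder_loc_bounded:
  assumes g: "holder_loc \<alpha> S g" and "\<alpha> > 0" and K: "compact K" "K \<subseteq> S"
  shows "\<exists>B. \<forall>(t, x)\<in>K. \<bar>g t x\<bar> \<le> B"
proof (cases "K = {}")
  case False
  then obtain s y where sy: "(s, y) \<in> K" by auto
  obtain L where "\<forall>(t, x)\<in>K. \<forall>(s, y)\<in>K. \<bar>g t x - g s y\<bar> \<le> L * (\<bar>t - s\<bar> powr (\<alpha>/2) + dist x y powr \<alpha>)"
    using g K unfolding holder_loc_def by meson
  then have L: "\<bar>g t x - g s y\<bar> \<le> L * (\<bar>t - s\<bar> powr (\<alpha>/2) + dist x y powr \<alpha>)" if "(t, x) \<in> K" for t x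
    using that sy by blast
  obtain D where D: "\<And>p. p \<in> K \<Longrightarrow> dist (s, y) p \<le> D"
    using compact_imp_bounded[OF K(1)] unfolding bounded_any_center[of K "(s, y)"] by auto
  have "\<bar>g t x\<bar> \<le> \<bar>g s y\<bar> + \<bar>L\<bar> * (D powr (\<alpha>/2) + D powr \<alpha>)" if tx: "(t, x) \<in> K" for t x
  proof -
    have "\<bar>t - s\<bar> \<le> D" "dist x y \<le> D"
      using D[OF tx] dist_fst_le[of "(s, y)" "(t, x)"] dist_snd_le[of "(s, y)" "(t, x)"]
      by (auto simp: dist_real_def dist_commute)
    then have "\<bar>t - s\<bar> powr (\<alpha>/2) + dist x y powr \<alpha> \<le> D powr (\<alpha>/2) + D powr \<alpha>"
      using \<open>\<alpha> > 0\<close> by (intro add_mono powr_mono2) auto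
    then have "L * (\<bar>t - s\<bar> powr (\<alpha>/2) + dist x y powr \<alpha>) \<le> \<bar>L\<bar> * (D powr (\<alpha>/2) + D powr \<alpha>)"
      by (intro mult_mono) auto
    then show ?thesis using L[OF tx] by linarith
  qed
  then show ?thesis by blast
qed simp

lemma (in lyapunov_strip) is_sol_imp_classical:
  assumes u: "is_sol \<alpha> q b c s f u" and "s \<in> {l..h}"
  shows "classical s u"
  unfolding classical_def
proof (intro conjI ballI allI)
  show "continuous_on ({s..h} \<times> UNIV) (\<lambda>(t, x). u t x)"
    using u unfolding is_sol_def by (elim conjE continuous_on_subset) auto
  \<comment> \<open>Boundedness in \<open>is_sol\<close> is stated for end times strictly after
    \<open>s\<close>; \<open>h + 1\<close> also covers \<open>s = h\<close>.\<close>
  have "bounded ((\<lambda>(t, x). u t x) ` ({s..h + 1} \<times> UNIV))"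
    using u assms(2) unfolding is_sol_def by simp
  then obtain B where "\<And>p. p \<in> {s..h + 1} \<times> UNIV \<Longrightarrow> norm ((\<lambda>(t, x). u t x) p) \<le> B"
    unfolding bounded_iff by blast
  then show "\<exists>B. \<forall>t\<in>{s..h}. \<forall>x. \<bar>u t x\<bar> \<le> B" by (intro exI[of _ B]) force
  show "C2 (u t)" if "t \<in> {s<..h}" for t using u that unfolding is_sol_def by auto
  show "((\<lambda>\<tau>. u \<tau> x) has_real_derivative Aop q b c t (u t) x) (at t)" if "t \<in> {s<..h}" for t x
    using u that unfolding is_sol_def by force
qed

lemma standing_hyps_lyapunov_strip:
  assumes hyps: "standing_hyps \<alpha> I q b c" and J: "{l..h} \<subseteq> I"
  shows "\<exists>\<Lambda> \<phi>. lyapunov_strip q b c l h \<Lambda> \<phi>"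
proof -
  have \<alpha>: "\<alpha> > 0"
    and q: "\<forall>i j. holder_loc \<alpha> (I \<times> UNIV) (\<lambda>t x. q t x i j)"
    and b: "\<forall>i. holder_loc \<alpha> (I \<times> UNIV) (\<lambda>t x. b t x i)"
    and c: "holder_loc \<alpha> (I \<times> UNIV) c"
    and c_bdd: "\<exists>c0. \<forall>t\<in>I. \<forall>x. c0 \<le> c t x"
    and sym: "\<forall>t\<in>I. \<forall>x i j. q t x i j = q t x j i"
    and elliptic: "\<exists>\<eta>. (\<forall>t\<in>I. \<forall>x \<xi>. (\<Sum>i\<in>UNIV. \<Sum>j\<in>UNIV. q t x i j * \<xi>$i * \<xi>$j) \<ge> \<eta> t x * (norm \<xi>)\<^sup>2)
          \<and> (\<exists>\<eta>0>0. \<forall>t\<in>I. \<forall>x. \<eta>0 \<le> \<eta> t x)"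
    and lyapunov: "\<forall>J. is_interval J \<and> bounded J \<and> J \<subseteq> I \<longrightarrow>
        (\<exists>\<phi> lam. C2 \<phi> \<and> (\<forall>x. \<phi> x > 0) \<and> filterlim \<phi> at_top at_infinity \<and>
            (\<forall>t\<in>J. \<forall>x. Aop q b c t \<phi> x \<le> lam * \<phi> x))"
    using hyps unfolding standing_hyps_def by - (elim conjE, assumption)+
  obtain c0 where c0: "\<And>t x. t \<in> I \<Longrightarrow> c0 \<le> c t x" using c_bdd by blast
  have "is_interval {l..h}" "bounded {l..h}" by (auto simp: is_interval_cc)
  then obtain \<phi> lam where \<phi>: "C2 \<phi>" "\<And>x. \<phi> x > 0" "filterlim \<phi> at_top at_infinity"
    and lam: "\<And>t x. t \<in> {l..h} \<Longrightarrow> Aop q b c t \<phi> x \<le> lam * \<phi> x"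
    using lyapunov J by meson
  \<comment> \<open>Dominates both \<open>lam\<close> and \<open>- c0\<close>; the summand 1 makes
    the two inequalities strict.\<close>
  define \<Lambda> where "\<Lambda> = \<bar>lam\<bar> + \<bar>c0\<bar> + 1"
  have "lyapunov_strip q b c l h \<Lambda> \<phi>"
  proof
    fix t x assume t: "t \<in> {l..h}"
    then have tI: "t \<in> I" using J by auto
    show "q t x i j = q t x j i" for i j using sym tI by blast
    obtain \<eta> \<eta>0 where \<eta>: "\<And>x v. (\<Sum>i\<in>UNIV. \<Sum>j\<in>UNIV. q t x i j * v$i * v$j) \<ge> \<eta> t x * (norm v)\<^sup>2"
      "\<eta>0 > 0" "\<And>x. \<eta>0 \<le> \<eta> t x"
      using elliptic tI by meson
    show "(\<Sum>i\<in>UNIV. \<Sum>j\<in>UNIV. q t x i j * v $ i * v $ j) > 0" if "v \<noteq> 0" for v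
    proof -
      have "\<eta> t x > 0" using \<eta>(2) \<eta>(3)[of x] by linarith
      then have "\<eta> t x * (norm v)\<^sup>2 > 0" using that by simp
      then show ?thesis using \<eta>(1)[of x v] by linarith
    qed
    have "lam * \<phi> x < \<Lambda> * \<phi> x"
      using \<phi>(2)[of x] by (intro mult_strict_right_mono) (auto simp: \<Lambda>_def)
    then show "Aop q b c t \<phi> x < \<Lambda> * \<phi> x" using lam[OF t, of x] by linarith
    show "- c t x < \<Lambda>" using c0[OF tI, of x] by (simp add: \<Lambda>_def)
  next
    fix R
    let ?K = "{l..h} \<times> cball (0::real^'a) R"
    have K: "compact ?K" "?K \<subseteq> I \<times> UNIV" using J by (auto intro: compact_Times)
    have bdd: "\<exists>B. \<forall>t\<in>{l..h}. \<forall>x\<in>cball 0 R. \<bar>g t x\<bar> \<le> B" 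
      if "holder_loc \<alpha> (I \<times> UNIV) g" for g :: "real \<Rightarrow> real^'a \<Rightarrow> real"
      using holder_loc_bounded[OF that \<alpha> K] by fastforce
    \<comment> \<open>The matrix indices are paired so that choice yields one function
      \<open>Bq\<close> on a finite type, whose range has a maximum.\<close>
    have "\<forall>p. \<exists>B. \<forall>t\<in>{l..h}. \<forall>x\<in>cball 0 R. \<bar>(\<lambda>(i, j). q t x i j) p\<bar> \<le> B"
      "\<forall>i. \<exists>B. \<forall>t\<in>{l..h}. \<forall>x\<in>cball 0 R. \<bar>b t x i\<bar> \<le> B"
      "\<exists>B. \<forall>t\<in>{l..h}. \<forall>x\<in>cball 0 R. \<bar>c t x\<bar> \<le> B"
      using q b c by (auto intro!: bdd)
    then obtain Bq Bb Bc where
      Bq: "\<And>p t x. t \<in> {l..h} \<Longrightarrow> x \<in> cball 0 R \<Longrightarrow> \<bar>(\<lambda>(i, j). q t x i j) p\<bar> \<le> Bq p"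
      and Bb: "\<And>i t x. t \<in> {l..h} \<Longrightarrow> x \<in> cball 0 R \<Longrightarrow> \<bar>b t x i\<bar> \<le> Bb i"
      and Bc: "\<And>t x. t \<in> {l..h} \<Longrightarrow> x \<in> cball 0 R \<Longrightarrow> \<bar>c t x\<bar> \<le> Bc"
      by metis
    define B where "B = Max (insert Bc (range Bq \<union> range Bb))"
    have le: "Bq p \<le> B" "Bb i \<le> B" "Bc \<le> B" for p i
      unfolding B_def by (rule Max_ge; simp)+
    have "\<bar>q t x i j\<bar> \<le> B" "\<bar>b t x i\<bar> \<le> B" "\<bar>c t x\<bar> \<le> B"
      if "t \<in> {l..h}" "x \<in> cball 0 R" for t x i j
      using order_trans[OF Bq[OF that, of "(i, j)"] le(1)] order_trans[OF Bb[OF that] le(2)]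
        order_trans[OF Bc[OF that] le(3)] by auto
    then show "\<exists>B. \<forall>t\<in>{l..h}. \<forall>x\<in>cball 0 R.
        (\<forall>i j. \<bar>q t x i j\<bar> \<le> B) \<and> (\<forall>i. \<bar>b t x i\<bar> \<le> B) \<and> \<bar>c t x\<bar> \<le> B" by blast
  qed (use \<phi> in \<open>auto simp: \<Lambda>_def\<close>)
  then show ?thesis by blast
qed

theorem theorem4p11:
  fixes \<alpha> :: real and I :: "real set"
    and q :: "real \<Rightarrow> real^'d::finite \<Rightarrow> 'd \<Rightarrow> 'd \<Rightarrow> real"
    and b :: "real \<Rightarrow> real^'d \<Rightarrow> 'd \<Rightarrow> real"
    and c :: "real \<Rightarrow> real^'d \<Rightarrow> real"
    and f :: "real^'d \<Rightarrow> real"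
  assumes hyps: "standing_hyps \<alpha> I q b c"
    and wellposed: "\<forall>s\<in>I. \<forall>g::real^'d \<Rightarrow> real. continuous_on UNIV g \<and> bounded (range g)
                        \<longrightarrow> (\<exists>!u. is_sol \<alpha> q b c s g u)"
    and H1: "\<forall>J. is_interval J \<and> bounded J \<and> J \<subseteq> I \<longrightarrow>
        (\<exists>\<psi> lam. C2 \<psi> \<and> (\<forall>x. \<psi> x > 0) \<and> filterlim \<psi> at_top at_infinity \<and>
            (\<forall>t\<in>J. \<forall>x. Aop0 q b t \<psi> x - lam * \<psi> x \<le> 0))"
    and H2: "\<forall>J. is_interval J \<and> bounded J \<and> J \<subseteq> I \<longrightarrow>
        (\<exists>\<phi> M. C2 \<phi> \<and> (\<forall>x. \<phi> x > 0) \<and> filterlim \<phi> at_top at_infinity \<and> M > 0 \<and>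
            (\<forall>t\<in>J. \<forall>x. Aop q b c t \<phi> x \<le> M))"
    and f_Cb: "continuous_on UNIV f" "bounded (range f)"
  shows "continuous_on {(t, s, x). t \<in> I \<and> s \<in> I \<and> s \<le> t}
           (\<lambda>(t, s, x). Gop \<alpha> q b c t s f x)"
proof -
  define U where "U s = (THE u. is_sol \<alpha> q b c s f u)" for s
  have U: "is_sol \<alpha> q b c s f (U s)" if "s \<in> I" for s
    unfolding U_def by (rule theI'[OF wellposed[rule_format, OF that conjI[OF f_Cb]]])
  have "\<forall>x. U s s x = f x" if "s \<in> I" for s
    using U[OF that] unfolding is_sol_def by (elim conjE)
  then have U_init: "U s s = f" if "s \<in> I" for s
    using that by blast
  \<comment> \<open>Since \<open>U s\<close> attains its datum, the case distinction at
    \<open>t = s\<close> disappears.\<close>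
  have G: "Gop \<alpha> q b c t s f x = U s t x" if "s \<in> I" for t s x
    using U_init[OF that] by (auto simp: Gop_def U_def)
  obtain K where K: "\<And>x. \<bar>f x\<bar> \<le> K" using f_Cb(2) by (auto simp: bounded_iff)
  have I: "I = UNIV \<or> (\<exists>a. I = {a..} \<or> I = {a<..})"
    using hyps unfolding standing_hyps_def by (elim conjE)
  have "\<exists>d>0. \<forall>t\<in>I. \<forall>s\<in>I. \<forall>x. s \<le> t \<and> \<bar>t - t0\<bar> < d \<and> \<bar>s - s0\<bar> < d \<and> dist x x0 < d \<longrightarrow>
      \<bar>U s t x - U s0 t0 x0\<bar> < e"
    if "t0 \<in> I" "s0 \<in> I" "s0 \<le> t0" "e > 0" for t0 s0 x0 e
  proof -
    \<comment> \<open>The strip must start inside \<open>I\<close> and yet contain all initial times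
      of \<open>I\<close> near \<open>s0\<close>. For a closed half-line its endpoint serves, even
      when \<open>s0\<close> is that endpoint; for an open one, the midpoint between endpoint and
      \<open>s0\<close>.\<close>
    obtain l r where lr: "l \<in> I" "l \<le> s0" "r > 0" "\<And>s. s \<in> I \<Longrightarrow> \<bar>s - s0\<bar> < r \<Longrightarrow> l \<le> s"
    proof -
      consider "I = UNIV" | a where "I = {a..}" | a where "I = {a<..}"
        using I by blast
      then show ?thesis
      proof cases
        case 1 then show ?thesis by (intro that[of "s0 - 1" 1]) auto
      next
        case 2 then show ?thesis using \<open>s0 \<in> I\<close> by (intro that[of a 1]) auto
      next
        case 3 then show ?thesis
          using \<open>s0 \<in> I\<close> by (intro that[of "(a + s0) / 2" "(s0 - a) / 2"])
          (auto simp: field_simps abs_less_iff)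
      qed
    qed
    define h where "h = t0 + 1"
    have "{l..h} \<subseteq> I" using lr(1) I by auto
    then obtain \<Lambda> \<phi> where "lyapunov_strip q b c l h \<Lambda> \<phi>"
      using standing_hyps_lyapunov_strip[OF hyps] by blast
    then interpret lyapunov_strip q b c l h \<Lambda> \<phi> .
    have classical: "classical s (U s)" if "s \<in> I" "s \<in> {l..h}" for s
      using is_sol_imp_classical[OF U] that .
    define R where "R = norm x0 + 1"
    have R: "x \<in> cball 0 R" if "dist x x0 < 1" for x
      using norm_triangle_sub[of x x0] that by (simp add: R_def dist_norm)
    have "e / 2 > 0" using \<open>e > 0\<close> by simp
    show ?thesis
    proof (cases "s0 = t0")
      \<comment> \<open>On the diagonal both values are compared with \<open>f\<close>, by means of
        the layer estimate that is uniform in \<open>s\<close>. The radius \<open>\<tau> / 2\<close>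
        gives \<open>t - s \<le> \<tau>\<close>.\<close>
      case True
      obtain \<tau> where \<tau>: "\<tau> > 0" "\<And>s u t y. s \<in> {l..h} \<Longrightarrow> classical s u \<Longrightarrow> u s = f \<Longrightarrow>
          t \<in> {s..h} \<Longrightarrow> y \<in> cball 0 R \<Longrightarrow> t - s \<le> \<tau> \<Longrightarrow> \<bar>u t y - f y\<bar> < e / 2"
        using initial_layer[OF f_Cb(1) K \<open>e / 2 > 0\<close>, of R] by meson
      obtain d where d: "d > 0" "\<And>x. dist x x0 < d \<Longrightarrow> \<bar>f x - f x0\<bar> < e / 2"
        using f_Cb(1) \<open>e / 2 > 0\<close> unfolding continuous_on_iff dist_real_def by (metis UNIV_I)
      show ?thesis
      proof (intro exI[of _ "Min {d, \<tau> / 2, r, 1}"] conjI ballI allI impI)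
        show "Min {d, \<tau> / 2, r, 1} > 0" using d \<tau> lr by simp
        fix t s x assume *: "t \<in> I" "s \<in> I"
          "s \<le> t \<and> \<bar>t - t0\<bar> < Min {d, \<tau> / 2, r, 1} \<and> \<bar>s - s0\<bar> < Min {d, \<tau> / 2, r, 1} \<and>
            dist x x0 < Min {d, \<tau> / 2, r, 1}"
        have s: "s \<in> {l..h}" and t: "t \<in> {s..h}" using * lr True by (auto simp: h_def)
        have "\<bar>t - s0\<bar> < \<tau> / 2" "\<bar>s - s0\<bar> < \<tau> / 2" using * True by auto
        then have "t - s \<le> \<tau>" by linarith
        then have "\<bar>U s t x - f x\<bar> < e / 2"
          using * s t by (intro \<tau>(2)[of s "U s" t x] classical U_init R) auto
        moreover have "\<bar>f x - f x0\<bar> < e / 2" using * by (intro d) auto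
        moreover have "U s0 t0 x0 = f x0" using U_init[OF \<open>s0 \<in> I\<close>] True by simp
        ultimately show "\<bar>U s t x - U s0 t0 x0\<bar> < e" by linarith
      qed
    next
      case False
      then have "s0 < t0" using \<open>s0 \<le> t0\<close> by simp
      obtain \<tau> where \<tau>: "\<tau> > 0" "\<And>s1 s2 u1 u2 t x. s1 \<in> {l..h} \<Longrightarrow> s2 \<in> {s1..h} \<Longrightarrow>
          classical s1 u1 \<Longrightarrow> u1 s1 = f \<Longrightarrow> classical s2 u2 \<Longrightarrow> u2 s2 = f \<Longrightarrow> s2 - s1 \<le> \<tau> \<Longrightarrow>
          t \<in> {s2..h} \<Longrightarrow> x \<in> cball 0 R \<Longrightarrow> \<bar>u1 t x - u2 t x\<bar> < e / 2"
        using stability_initial_time[OF f_Cb(1) K \<open>e / 2 > 0\<close>, of R] by meson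
      have "continuous_on ({s0..} \<times> UNIV) (\<lambda>(t, x). U s0 t x)"
        using U[OF \<open>s0 \<in> I\<close>] unfolding is_sol_def by (elim conjE)
      then obtain d where d: "d > 0" "\<And>p. p \<in> {s0..} \<times> UNIV \<Longrightarrow> dist p (t0, x0) < d \<Longrightarrow>
          dist ((\<lambda>(t, x). U s0 t x) p) ((\<lambda>(t, x). U s0 t x) (t0, x0)) < e / 2"
        using \<open>s0 < t0\<close> \<open>e / 2 > 0\<close> unfolding continuous_on_iff
        by (metis UNIV_I atLeast_iff less_imp_le mem_Sigma_iff)
      \<comment> \<open>The last entry keeps \<open>t\<close> above \<open>s0\<close>, where the
        solution \<open>U s0\<close> may be evaluated. The entry \<open>d / 2\<close> is halved
        because the distance of pairs is bounded by the sum of two distances.\<close>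
      define m where "m = Min {d / 2, \<tau>, r, 1, (t0 - s0) / 2}"
      show ?thesis
      proof (intro exI[of _ m] conjI ballI allI impI)
        show "m > 0" using d \<tau> lr \<open>s0 < t0\<close> by (simp add: m_def)
        fix t s x assume *: "t \<in> I" "s \<in> I"
          "s \<le> t \<and> \<bar>t - t0\<bar> < m \<and> \<bar>s - s0\<bar> < m \<and> dist x x0 < m"
        have m: "m \<le> d / 2" "m \<le> \<tau>" "m \<le> r" "m \<le> 1" "m \<le> (t0 - s0) / 2"
          unfolding m_def by (rule Min_le; simp)+
        have "t0 - t < m" "t - t0 < m" using * by auto
        then have "s0 < t" "t < h" using m(4,5) \<open>s0 < t0\<close> by (auto simp: h_def field_simps)
        with * m(1-4) have near: "\<bar>t - t0\<bar> < d / 2" "dist x x0 < d / 2" "dist x x0 < 1"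
          "\<bar>s - s0\<bar> \<le> \<tau>" "\<bar>s - s0\<bar> < r" "t < h" "s0 < t"
          by linarith+
        have s: "s \<in> {l..h}" and s0: "s0 \<in> {l..h}"
          using near lr * \<open>s0 < t0\<close> by (auto simp: h_def)
        have "\<bar>U s t x - U s0 t x\<bar> < e / 2"
        \<comment> \<open>The stability estimate takes the earlier initial time first, so the two
          solutions exchange roles.\<close>
        proof (cases "s \<le> s0")
          case True
          then show ?thesis
            using s s0 near * \<open>s0 \<in> I\<close> by (intro \<tau>(2)[of s s0 "U s" "U s0"] classical U_init R) auto
        next
          case False
          then have "\<bar>U s0 t x - U s t x\<bar> < e / 2"
            using s s0 near * \<open>s0 \<in> I\<close> by (intro \<tau>(2)[of s0 s "U s0" "U s"] classical U_init R) auto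
          then show ?thesis by (simp add: abs_minus_commute)
        qed
        moreover have "dist (t, x) (t0, x0) < d"
        proof -
          have "dist (t, x) (t0, x0) \<le> dist t t0 + dist x x0"
            unfolding dist_Pair_Pair by (rule sqrt_sum_squares_le_sum) auto
          then show ?thesis using near by (simp add: dist_real_def)
        qed
        then have "\<bar>U s0 t x - U s0 t0 x0\<bar> < e / 2"
          using d(2)[of "(t, x)"] near by (simp add: dist_real_def)
        ultimately show "\<bar>U s t x - U s0 t0 x0\<bar> < e" by linarith
      qed
    qed
  qed
  note key = this
  show ?thesis
    unfolding continuous_on_iff
  proof (intro ballI allI impI)
    fix p and e :: real
    assume p: "p \<in> {(t, s, x :: real^'d). t \<in> I \<and> s \<in> I \<and> s \<le> t}" and e: "e > 0"
    obtain t0 s0 x0 where p_eq: "p = (t0, s0, x0)" by (cases p)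
    then have p': "t0 \<in> I" "s0 \<in> I" "s0 \<le> t0" using p by auto
    obtain d where d: "d > 0" "\<And>t s x. t \<in> I \<Longrightarrow> s \<in> I \<Longrightarrow> s \<le> t \<Longrightarrow> \<bar>t - t0\<bar> < d \<Longrightarrow> \<bar>s - s0\<bar> < d \<Longrightarrow>
        dist x x0 < d \<Longrightarrow> \<bar>U s t x - U s0 t0 x0\<bar> < e"
      using key[OF p' e, of x0] by blast
    show "\<exists>d>0. \<forall>p'\<in>{(t, s, x). t \<in> I \<and> s \<in> I \<and> s \<le> t}. dist p' p < d \<longrightarrow>
        dist (case p' of (t, s, x) \<Rightarrow> Gop \<alpha> q b c t s f x) (case p of (t, s, x) \<Rightarrow> Gop \<alpha> q b c t s f x) < e"
    proof (intro exI[of _ d] conjI ballI impI d(1))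
      fix p' assume p': "p' \<in> {(t, s, x). t \<in> I \<and> s \<in> I \<and> s \<le> t}" and near: "dist p' p < d"
      obtain t s x where p'_eq: "p' = (t, s, x)" by (cases p')
      have "dist t t0 < d" "dist (s, x) (s0, x0) < d"
        using near dist_fst_le[of p' p] dist_snd_le[of p' p] by (auto simp: p_eq p'_eq)
      moreover from this(2) have "dist s s0 < d" "dist x x0 < d"
        using dist_fst_le[of "(s, x)" "(s0, x0)"] dist_snd_le[of "(s, x)" "(s0, x0)"] by auto
      ultimately show "dist (case p' of (t, s, x) \<Rightarrow> Gop \<alpha> q b c t s f x)
          (case p of (t, s, x) \<Rightarrow> Gop \<alpha> q b c t s f x) < e"
        using d(2)[of t s x] p' G \<open>s0 \<in> I\<close> by (simp add: p_eq p'_eq dist_real_def)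
    qed
  qed
qed

end
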